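(* Let $R,L,d\in(0,\infty)$ and $\alpha\in(0,1]$. Every sequence $(\Sigma_j)_{j\in\mathbb{N}}\subset\mathscr{C}^{1,\alpha}_{m,n}(R,L,d)$ has a subsequence which converges in $\mathscr{C}^{1,\alpha}_{m,n}$ to some submanifold $\Sigma_0\in\mathscr{C}^{1,\alpha}_{m,n}(R,L,d)$.
   Context: $\mathscr{C}^{1,\alpha}_{m,n}$ is the set of compact $C^{1,\alpha}$ embedded $m$-dimensional submanifolds of $\mathbb{R}^n$. $\mathscr{C}^{1,\alpha}_{m,n}(R,L,d)$ is the set of $\Sigma\in\mathscr{C}^{1,\alpha}_{m,n}$ such that: (i) $\Sigma\subset\overline{B}^n(0,d)$; (ii) for each $x\in\Sigma$ there is $f_x\in C^{1,\alpha}(T_x\Sigma,(T_x\Sigma)^\perp)$ with $\Sigma\cap B(x,R)=(x+\operatorname{graph}f_x)\cap B(x,R)$, $f_x(0)=0$, $Df_x(0)=0$; (iii) $\|Df_x(\xi)-Df_x(\eta)\|\le L|\xi-\eta|^\alpha$ for all $\xi,\eta\in T_x\Sigma$ and $\operatorname{lip}(f_x)\le1$. A sequence $(\Sigma_j)\subset\mathscr{C}^{1,\alpha}_{m,n}$ converges in $\mathscr{C}^{1,\alpha}_{m,n}$ to a set $\Sigma_0\subset\mathbb{R}^n$ if: (a) $d_{\mathcal{H}}(\Sigma_j,\Sigma_0)\to0$; (b) $\Sigma_0$ is a $C^{1,\alpha}$ embedded submanifold; (c) there are $j_0\in\mathbb{N}$ and $\rho>0$ such that for each $x\in\Sigma_0$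 and each $j\ge j_0$ or $j=0$ there is $f_{x,j}\in C^{1,\alpha}(T_x\Sigma_0,(T_x\Sigma_0)^\perp)$ with $\Sigma_j\cap B(x,\rho)=(x+\operatorname{graph}f_{x,j})\cap B(x,\rho)$ and $\|f_{x,j}-f_{x,0}\|_{C^{1,\alpha'}}\to0$ as $j\to\infty$ for each $\alpha'\in(0,\alpha)$. Here $d_{\mathcal{H}}(A,B)=\sup_{y\in A}\operatorname{dist}(y,B)+\sup_{z\in B}\operatorname{dist}(z,A)$. *)

theory Defs
  imports "HOL-Analysis.Analysis"
begin

text \<open>Ambient space R^n is an arbitrary Euclidean space 'a (n = DIM('a)).
Linear subspaces T are subsets of 'a; a map T -> T^perp is a map f :: 'a => 'a
considered on T only, with values in the orthogonal complement (orthogonal_comp T).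
Derivatives are taken within T, and linear maps T -> T^perp are only ever
evaluated on vectors of T.\<close>

text \<open>Tangent space of a set S at x (Bouligand tangent cone; for a C^1
submanifold this is the usual tangent space).\<close>
definition tangent_space :: "'a::euclidean_space set \<Rightarrow> 'a \<Rightarrow> 'a set" where
  "tangent_space S x =
     {v. \<exists>y t. (\<forall>k. y k \<in> S) \<and> y \<longlonglongrightarrow> x \<and> (\<forall>k. t k \<ge> (0::real))
            \<and> (\<lambda>k. t k *\<^sub>R (y k - x)) \<longlonglongrightarrow> v}"

definition graph_over :: "'a::euclidean_space set \<Rightarrow> ('a \<Rightarrow> 'a) \<Rightarrow> 'a set" where
  "graph_over T f = (\<lambda>\<xi>. \<xi> + f \<xi>) ` T"

definition C1a_on ::
  "'a::euclidean_space set \<Rightarrow> real \<Rightarrow> ('a \<Rightarrow> 'a) \<Rightarrow> ('a \<Rightarrow> 'a \<Rightarrow> 'a) \<Rightarrow> bool" where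
  "C1a_on T \<alpha> f Df \<longleftrightarrow>
     (\<forall>\<xi>\<in>T. f \<xi> \<in> orthogonal_comp T) \<and>
     (\<forall>\<xi>\<in>T. (f has_derivative Df \<xi>) (at \<xi> within T)) \<and>
     (\<forall>r>0. \<exists>C. \<forall>\<xi>\<in>T. \<forall>\<eta>\<in>T. norm \<xi> \<le> r \<longrightarrow> norm \<eta> \<le> r \<longrightarrow>
        (\<forall>v\<in>T. norm (Df \<xi> v - Df \<eta> v) \<le> C * norm (\<xi> - \<eta>) powr \<alpha> * norm v))"

definition C1a_submanifold :: "nat \<Rightarrow> real \<Rightarrow> 'a::euclidean_space set \<Rightarrow> bool" where
  "C1a_submanifold m \<alpha> \<Sigma> \<longleftrightarrow>
     (\<forall>x\<in>\<Sigma>. \<exists>T r f Df. subspace T \<and> dim T = m \<and> r > 0 \<and> C1a_on T \<alpha> f Df \<and>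
        \<Sigma> \<inter> ball x r = ((+) x ` graph_over T f) \<inter> ball x r)"

definition C1a_class :: "nat \<Rightarrow> real \<Rightarrow> 'a::euclidean_space set \<Rightarrow> bool" where
  "C1a_class m \<alpha> \<Sigma> \<longleftrightarrow> compact \<Sigma> \<and> C1a_submanifold m \<alpha> \<Sigma>"

definition C1a_class_RLd ::
  "nat \<Rightarrow> real \<Rightarrow> real \<Rightarrow> real \<Rightarrow> real \<Rightarrow> 'a::euclidean_space set \<Rightarrow> bool" where
  "C1a_class_RLd m \<alpha> R L d \<Sigma> \<longleftrightarrow>
     C1a_class m \<alpha> \<Sigma> \<and> \<Sigma> \<subseteq> cball 0 d \<and>
     (\<forall>x\<in>\<Sigma>. \<exists>f Df.
        C1a_on (tangent_space \<Sigma> x) \<alpha> f Df \<and>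
        \<Sigma> \<inter> ball x R = ((+) x ` graph_over (tangent_space \<Sigma> x) f) \<inter> ball x R \<and>
        f 0 = 0 \<and> (\<forall>v\<in>tangent_space \<Sigma> x. Df 0 v = 0) \<and>
        (\<forall>\<xi>\<in>tangent_space \<Sigma> x. \<forall>\<eta>\<in>tangent_space \<Sigma> x. \<forall>v\<in>tangent_space \<Sigma> x.
            norm (Df \<xi> v - Df \<eta> v) \<le> L * norm (\<xi> - \<eta>) powr \<alpha> * norm v) \<and>
        (\<forall>\<xi>\<in>tangent_space \<Sigma> x. \<forall>\<eta>\<in>tangent_space \<Sigma> x.
            norm (f \<xi> - f \<eta>) \<le> norm (\<xi> - \<eta>)))"

text \<open>Hausdorff convergence d_H(S j, S0) -> 0 (stated without suprema;
equivalent to the sum-of-suprema definition tending to 0).\<close>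
definition hausdorff_conv :: "(nat \<Rightarrow> 'a::metric_space set) \<Rightarrow> 'a set \<Rightarrow> bool" where
  "hausdorff_conv S S0 \<longleftrightarrow>
     (\<forall>\<epsilon>>0. eventually (\<lambda>j. (\<forall>y\<in>S j. \<exists>z\<in>S0. dist y z < \<epsilon>) \<and>
                              (\<forall>z\<in>S0. \<exists>y\<in>S j. dist z y < \<epsilon>)) sequentially)"

definition C1a_norm_tendsto_zero ::
  "'a::euclidean_space set \<Rightarrow> real \<Rightarrow> (nat \<Rightarrow> 'a \<Rightarrow> 'a) \<Rightarrow> (nat \<Rightarrow> 'a \<Rightarrow> 'a \<Rightarrow> 'a) \<Rightarrow> bool" where
  "C1a_norm_tendsto_zero T \<beta> g Dg \<longleftrightarrow>
     (\<forall>\<epsilon>>0. eventually (\<lambda>j.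
        (\<forall>\<xi>\<in>T. norm (g j \<xi>) \<le> \<epsilon>) \<and>
        (\<forall>\<xi>\<in>T. \<forall>v\<in>T. norm (Dg j \<xi> v) \<le> \<epsilon> * norm v) \<and>
        (\<forall>\<xi>\<in>T. \<forall>\<eta>\<in>T. \<forall>v\<in>T.
            norm (Dg j \<xi> v - Dg j \<eta> v) \<le> \<epsilon> * norm (\<xi> - \<eta>) powr \<beta> * norm v))
      sequentially)"

definition C1a_converges ::
  "nat \<Rightarrow> real \<Rightarrow> (nat \<Rightarrow> 'a::euclidean_space set) \<Rightarrow> 'a set \<Rightarrow> bool" where
  "C1a_converges m \<alpha> S S0 \<longleftrightarrow>
     hausdorff_conv S S0 \<and>
     C1a_submanifold m \<alpha> S0 \<and>
     (\<exists>(j0::nat) \<rho>. \<rho> > 0 \<and>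
        (\<forall>x\<in>S0. \<exists>F DF F0 DF0.
           C1a_on (tangent_space S0 x) \<alpha> F0 DF0 \<and>
           S0 \<inter> ball x \<rho> = ((+) x ` graph_over (tangent_space S0 x) F0) \<inter> ball x \<rho> \<and>
           (\<forall>j\<ge>j0. C1a_on (tangent_space S0 x) \<alpha> (F j) (DF j) \<and>
              S j \<inter> ball x \<rho> = ((+) x ` graph_over (tangent_space S0 x) (F j)) \<inter> ball x \<rho>) \<and>
           (\<forall>\<beta>. 0 < \<beta> \<and> \<beta> < \<alpha> \<longrightarrow>
              C1a_norm_tendsto_zero (tangent_space S0 x) \<beta>
                 (\<lambda>j \<xi>. F j \<xi> - F0 \<xi>) (\<lambda>j \<xi> v. DF j \<xi> v - DF0 \<xi> v))))"

end

theory Submission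
  imports Defs "HOL-Complex_Analysis.Great_Picard"
begin

text \<open>
Blaschke's selection theorem gives a Hausdorff convergent subsequence with limit \<open>S0\<close>. Precompose
the graph function of each chart with the orthogonal projection onto its tangent plane: the charts
around points \<open>x j\<close> converging to \<open>x \<in> S0\<close> then become equicontinuous functions on the whole space,
and a pointwise limit of a subsequence is a chart of \<open>S0\<close> at \<open>x\<close> with the same constants, because the
remainder estimate \<open>|g w - g z - A z (w - z)| \<le> L |w - z|\<^bsup>1 + \<alpha>\<^esup>\<close> survives pointwise limits.

Tangent planes at nearby points of two sets of the class that are Hausdorff close are uniformly close,
so eventually every chart of \<open>S j\<close> can be rewritten as a graph over the tangent plane of \<open>S0\<close>.
These graph functions are multiplied by a cutoff and compared with the chart of \<open>S0\<close>. Hausdorff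
convergence makes the difference uniformly small, and the uniform remainder estimate upgrades this to
convergence in \<open>C\<^bsup>1,\<beta>\<^esup>\<close> for all \<open>\<beta> < \<alpha>\<close>. The further subsequences
depend on \<open>x\<close> and serve only to identify \<open>S0\<close>; convergence holds along Blaschke's subsequence.
\<close>

section \<open>Orthogonal projections\<close>

text \<open>Two obstacles shape the argument. The charts of different sets live over different
  planes, so there is no common domain on which to take limits. A plane is therefore encoded by its
  orthogonal projection, and closeness of planes becomes closeness in operator norm. Moreover,
  convergence in norm is demanded on the entire tangent plane, while the sets determine the graph
  functions only near the base point; the cutoff keeps the graph near x and returns to the limit
  chart further out. Regularity is carried by first-order expansions with a uniform remainder,
  because these survive limits, a change of plane and products with a cutoff, and still give back
  Hoelder bounds for the derivatives. Projections at distance at most 1/6 make the change of plane a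
  perturbation with Lipschitz constant 1/2. A chart of radius R around y covers the ball of radius
  R/2 around x once y is close to x, and the final radius R/16 leaves room for a cutoff that
  vanishes from R/8 on. None of these constants depends on x, which is what the uniform
  \<open>j0\<close> and \<rho> of the definition require.\<close>

definition oproj :: "('a::euclidean_space \<Rightarrow>\<^sub>L 'a) \<Rightarrow> bool" where
  "oproj P \<longleftrightarrow> (\<forall>x. P (P x) = P x) \<and> (\<forall>x y. P x \<bullet> y = x \<bullet> P y)"

lemma oprojD:
  assumes "oproj P"
  shows oproj_idem: "P (P x) = P x" and oproj_self_adjoint: "P x \<bullet> y = x \<bullet> P y"
  using assms by (auto simp: oproj_def)

lemma oproj_range_iff: "oproj P \<Longrightarrow> x \<in> range P \<longleftrightarrow> P x = x"
  by (metis oproj_idem rangeE rangeI)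

lemma subspace_range_blinfun: "subspace (range (blinfun_apply P))"
  by (intro linear_subspace_image subspace_UNIV bounded_linear.linear blinfun.bounded_linear_right)

lemma oproj_norm_le:
  assumes "oproj P" shows "norm (P x) \<le> norm x"
proof -
  have "(norm (P x))\<^sup>2 = x \<bullet> P x"
    by (metis assms oproj_idem oproj_self_adjoint power2_norm_eq_inner)
  also have "\<dots> \<le> norm x * norm (P x)" by (rule norm_cauchy_schwarz)
  finally show ?thesis by (cases "P x = 0") (auto simp: power2_eq_square)
qed

lemma oproj_compl_norm_le:
  assumes "oproj P" shows "norm (x - P x) \<le> norm x"
proof -
  have "(norm (x - P x))\<^sup>2 = x \<bullet> (x - P x)"
    using oprojD[OF assms] by (simp add: power2_norm_eq_inner algebra_simps inner_commute)
  also have "\<dots> \<le> norm x * norm (x - P x)" by (rule norm_cauchy_schwarz)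
  finally show ?thesis by (cases "x - P x = 0") (auto simp: power2_eq_square)
qed

lemma oproj_norm_blinfun_le: "oproj P \<Longrightarrow> norm P \<le> 1"
  by (rule norm_blinfun_bound) (auto simp: oproj_norm_le)

lemma orthogonal_comp_oproj_iff:
  assumes "oproj P" shows "y \<in> orthogonal_comp (range P) \<longleftrightarrow> P y = 0"
proof
  assume "y \<in> orthogonal_comp (range P)"
  then have "P y \<bullet> y = 0" by (auto simp: orthogonal_comp_def orthogonal_def)
  then have "P y \<bullet> P y = 0" by (metis assms oproj_idem oproj_self_adjoint)
  then show "P y = 0" by simp
next
  assume "P y = 0"
  then show "y \<in> orthogonal_comp (range P)"
    by (auto simp: orthogonal_comp_def orthogonal_def oproj_self_adjoint[OF assms])
qed

text \<open>The Gram-Schmidt residual \<open>a - p a\<close> is orthogonal to T. This one fact shows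
  that \<open>p\<close> fixes T and that \<open>p\<close> is self-adjoint, both inner products being
  equal to \<open>p x \<bullet> p y\<close>.\<close>

lemma oproj_exists:
  fixes T :: "'a::euclidean_space set"
  assumes "subspace T"
  obtains P where "oproj P" "range (blinfun_apply P) = T"
proof -
  obtain B where B: "B \<subseteq> T" "pairwise orthogonal B" "span B = T" "independent B"
    using orthonormal_basis_subspace[OF assms] by metis
  have finB: "finite B" using B(4) independent_imp_finite by blast
  define p where "p a = (\<Sum>b\<in>B. (b \<bullet> a / (b \<bullet> b)) *\<^sub>R b)" for a
  have "linear p"
    unfolding p_def
    by (intro linearI) (simp_all add: inner_add_right add_divide_distrib algebra_simps sum.distrib scaleR_sum_right)
  then have bl: "bounded_linear p" by (rule linear_conv_bounded_linear[THEN iffD1])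
  define P where "P = Blinfun p"
  have Pp: "blinfun_apply P = p" using bl by (simp add: P_def bounded_linear_Blinfun_apply)
  have inT: "p x \<in> T" for x
    unfolding p_def using B(1) assms by (auto intro!: subspace_sum subspace_scale)
  have orth: "x \<bullet> (a - p a) = 0" if "x \<in> T" for x a
    using Gram_Schmidt_step[OF B(2), of x a] that B(3) by (simp add: orthogonal_def p_def)
  have fixT: "p x = x" if "x \<in> T" for x
  proof -
    have "(x - p x) \<bullet> (x - p x) = 0" using orth that inT assms subspace_diff by metis
    then show ?thesis by simp
  qed
  have sa: "p x \<bullet> y = x \<bullet> p y" for x y
  proof -
    have "p x \<bullet> y = p x \<bullet> p y" using orth[OF inT, of x y] by (simp add: inner_diff_right)
    also have "\<dots> = x \<bullet> p y" using orth[OF inT, of y x] by (simp add: inner_diff_right inner_commute)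
    finally show ?thesis .
  qed
  have "oproj P" unfolding oproj_def Pp using fixT inT sa by auto
  moreover have "range P = T" unfolding Pp using fixT inT by (metis image_subsetI rangeI subsetI subset_antisym)
  ultimately show thesis by (rule that)
qed

text \<open>A vector of \<open>range P\<close> killed by Q satisfies \<open>v = (P - Q) v\<close>
  and must vanish, so Q embeds \<open>range P\<close> into \<open>range Q\<close>. This is how the
  dimension m reaches a limit plane.\<close>

lemma oproj_dim_le:
  assumes "oproj P" "oproj Q" "norm (P - Q) < 1"
  shows "dim (range (blinfun_apply P)) \<le> dim (range (blinfun_apply Q))"
proof -
  have inj: "inj_on Q (range P)"
  proof (rule linear_inj_on_iff_eq_0[THEN iffD2, rule_format])
    show "linear Q" by (intro bounded_linear.linear blinfun.bounded_linear_right)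
    show "subspace (range P)" by (rule subspace_range_blinfun)
    fix v assume v: "v \<in> range P" and "Q v = 0"
    then have "P v = v" using oproj_range_iff[OF assms(1)] by blast
    then have "v = (P - Q) v" using \<open>Q v = 0\<close> by (simp add: blinfun.diff_left)
    then have "norm v \<le> norm (P - Q) * norm v" by (metis norm_blinfun)
    then show "v = 0" using assms(3) by (cases "v = 0") auto
  qed
  have "dim (range P) = dim (Q ` range P)"
    using inj by (metis blinfun.bounded_linear_right bounded_linear.linear dim_image_eq span_eq_iff subspace_range_blinfun)
  also have "\<dots> \<le> dim (range Q)" by (intro dim_subset) auto
  finally show ?thesis .
qed

lemma oproj_dim_eq:
  assumes "oproj P" "oproj Q" "norm (P - Q) < 1"
  shows "dim (range (blinfun_apply P)) = dim (range (blinfun_apply Q))"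
  using oproj_dim_le[OF assms] oproj_dim_le[OF assms(2,1)] assms(3)
  by (simp add: norm_minus_commute)

text \<open>P - Q splits as (1 - Q) P - Q (1 - P), and each hypothesis bounds one summand, whence
  the factor 2. Closeness of tangent planes is obtained in this vectorwise form, once in each
  direction.\<close>

lemma oproj_norm_diff_le:
  assumes P: "oproj P" and Q: "oproj Q"
    and 1: "\<And>v. v \<in> range P \<Longrightarrow> norm (v - Q v) \<le> c * norm v"
    and 2: "\<And>v. v \<in> range Q \<Longrightarrow> norm (v - P v) \<le> c * norm v" and "c \<ge> 0"
  shows "norm (P - Q) \<le> 2 * c"
proof -
  note PP = oprojD[OF P] and QQ = oprojD[OF Q]
  have a: "norm (P x - Q (P x)) \<le> c * norm x" for x
    using 1[of "P x"] mult_left_mono[OF oproj_norm_le[OF P, of x] \<open>c \<ge> 0\<close>] by force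
  \<comment> \<open>\<open>Q (1 - P)\<close> is the adjoint of \<open>(1 - P) Q\<close>.\<close>
  have b: "norm (Q (x - P x)) \<le> c * norm x" for x
  proof -
    define y where "y = Q (x - P x)"
    have "(norm y)\<^sup>2 = y \<bullet> (x - P x)"
      unfolding y_def by (metis QQ power2_norm_eq_inner)
    also have "\<dots> = (y - P y) \<bullet> x"
      using PP by (simp add: inner_diff_left inner_diff_right)
    also have "\<dots> \<le> norm (y - P y) * norm x" by (rule norm_cauchy_schwarz)
    also have "\<dots> \<le> c * norm y * norm x"
      using 2[of y] by (intro mult_right_mono) (auto simp: y_def)
    finally have "norm y * norm y \<le> (c * norm x) * norm y" by (simp add: power2_eq_square mult_ac)
    then have "norm y \<le> c * norm x"
      using \<open>c \<ge> 0\<close> by (cases "y = 0") auto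
    then show ?thesis by (simp add: y_def)
  qed
  show ?thesis
  proof (rule norm_blinfun_bound)
    fix x
    have "(P - Q) x = (P x - Q (P x)) - Q (x - P x)"
      by (simp add: blinfun.diff_left blinfun.diff_right)
    then show "norm ((P - Q) x) \<le> 2 * c * norm x"
      using a[of x] b[of x] norm_triangle_ineq4[of "P x - Q (P x)" "Q (x - P x)"] by simp
  qed (use \<open>c \<ge> 0\<close> in simp)
qed

section \<open>Tangent spaces and charts\<close>

text \<open>The plane of a given graph need not be tangent, so the cone is the graph of the
  differential over it. Since f takes values in the kernel of P, the parameter of a point y is
  \<open>P (y - x)\<close>; rescaled secants of the set thus become rescaled parameters, and
  differentiability at 0 handles their limit.\<close>

lemma tangent_space_graph:
  fixes \<Sigma> :: "'a::euclidean_space set"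
  assumes P: "oproj P" and x: "x \<in> \<Sigma>" and "r > 0"
    and f: "\<And>\<xi>. \<xi> \<in> range P \<Longrightarrow> P (f \<xi>) = 0"
    and D: "(f has_derivative D) (at 0 within range P)"
    and eq: "\<Sigma> \<inter> ball x r = ((+) x ` graph_over (range P) f) \<inter> ball x r"
  shows "f 0 = 0" and "\<And>v. v \<in> range P \<Longrightarrow> P (D v) = 0"
    and "tangent_space \<Sigma> x = (\<lambda>v. v + D v) ` range P"
proof -
  have lin: "bounded_linear D" using D by (rule has_derivative_bounded_linear)
  have param: "\<exists>\<xi>\<in>range P. y = x + \<xi> + f \<xi> \<and> \<xi> = P (y - x)" if "y \<in> \<Sigma>" "y \<in> ball x r" for y
  proof -
    have "y \<in> (+) x ` graph_over (range P) f" using that eq by blast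
    then obtain \<xi> where \<xi>: "\<xi> \<in> range P" "y = x + (\<xi> + f \<xi>)" by (auto simp: graph_over_def)
    have "P \<xi> = \<xi>" "P (f \<xi>) = 0" using oproj_range_iff[OF P] f \<xi>(1) by blast+
    then have "P (y - x) = \<xi>" using \<xi>(2) by (simp add: blinfun.add_right)
    then show ?thesis using \<xi> by (intro bexI[of _ \<xi>]) (simp_all add: add.assoc)
  qed
  show f0: "f 0 = 0"
  proof -
    obtain \<xi> where "x = x + \<xi> + f \<xi>" "\<xi> = P (x - x)" using param[OF x] \<open>r > 0\<close> by auto
    then show ?thesis by (simp add: blinfun.zero_right)
  qed
  have dl: "((\<lambda>y. norm (f y - D y) / norm y) \<longlongrightarrow> 0) (at 0 within range P)"
    using D unfolding has_derivative_iff_norm by (simp add: f0)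
  have est: "\<exists>\<delta>>0. \<forall>\<xi>\<in>range P. norm \<xi> < \<delta> \<longrightarrow> norm (f \<xi> - D \<xi>) \<le> e * norm \<xi>" if "e > 0" for e
  proof -
    have "eventually (\<lambda>y. norm (f y - D y) / norm y < e) (at 0 within range P)"
      using order_tendstoD(2)[OF dl that] .
    then obtain \<delta> where "\<delta> > 0" and \<delta>: "\<forall>\<xi>\<in>range P. \<xi> \<noteq> 0 \<and> dist \<xi> 0 < \<delta> \<longrightarrow> norm (f \<xi> - D \<xi>) / norm \<xi> < e"
      unfolding eventually_at by blast
    have "norm (f \<xi> - D \<xi>) \<le> e * norm \<xi>" if "\<xi> \<in> range P" "norm \<xi> < \<delta>" for \<xi>
    proof (cases "\<xi> = 0")
      case True
      then show ?thesis using f0 lin by (simp add: linear_simps)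
    next
      case False
      then have "norm (f \<xi> - D \<xi>) / norm \<xi> < e" using \<delta>[rule_format, OF that(1)] that(2) by simp
      then have "norm (f \<xi> - D \<xi>) < e * norm \<xi>" using False pos_divide_less_eq[of "norm \<xi>"] by simp
      then show ?thesis by simp
    qed
    then show ?thesis using \<open>\<delta> > 0\<close> by blast
  qed
  \<comment> \<open>The multipliers \<open>t k\<close> may tend to infinity. The product
    \<open>t k *\<^sub>R \<xi> k\<close> is bounded because it converges, and this absorbs an error
    that is small relative to the norm of \<open>\<xi> k\<close>.\<close>
  have lim: "(\<lambda>k. t k *\<^sub>R f (\<xi> k)) \<longlonglongrightarrow> D u"
    if \<xi>: "\<And>k. \<xi> k \<in> range P" "\<xi> \<longlonglongrightarrow> 0" "(\<lambda>k. t k *\<^sub>R \<xi> k) \<longlonglongrightarrow> u" "\<And>k. t k \<ge> 0" for \<xi> t u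
  proof -
    have "(\<lambda>k. t k *\<^sub>R (f (\<xi> k) - D (\<xi> k))) \<longlonglongrightarrow> 0"
    proof (rule tendstoI)
      fix e :: real assume "e > 0"
      obtain M where M: "M > 0" "\<And>k. norm (t k *\<^sub>R \<xi> k) \<le> M"
        using convergent_imp_Bseq[OF convergentI[OF \<xi>(3)]] by (rule BseqE) blast
      have "e / (2*M) > 0" using \<open>e > 0\<close> M by simp
      from est[OF this] obtain \<delta> where "\<delta> > 0"
        and \<delta>: "\<And>\<xi>. \<xi> \<in> range P \<Longrightarrow> norm \<xi> < \<delta> \<Longrightarrow> norm (f \<xi> - D \<xi>) \<le> e / (2*M) * norm \<xi>" by blast
      have "eventually (\<lambda>k. norm (\<xi> k) < \<delta>) sequentially"
        using tendstoD[OF \<xi>(2) \<open>\<delta> > 0\<close>] by simp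
      then show "eventually (\<lambda>k. dist (t k *\<^sub>R (f (\<xi> k) - D (\<xi> k))) 0 < e) sequentially"
      proof eventually_elim
        case (elim k)
        have "norm (t k *\<^sub>R (f (\<xi> k) - D (\<xi> k))) = t k * norm (f (\<xi> k) - D (\<xi> k))"
          using \<xi>(4) by simp
        also have "\<dots> \<le> t k * (e / (2*M) * norm (\<xi> k))"
          using \<delta>[OF \<xi>(1) elim] \<xi>(4) by (intro mult_left_mono) auto
        also have "\<dots> = e / (2*M) * norm (t k *\<^sub>R \<xi> k)" using \<xi>(4) by simp
        also have "\<dots> \<le> e / (2*M) * M" using M \<open>e > 0\<close> by (intro mult_left_mono) auto
        also have "\<dots> < e" using M \<open>e > 0\<close> by simp
        finally show ?case by simp
      qed
    qed
    moreover have "(\<lambda>k. D (t k *\<^sub>R \<xi> k)) \<longlonglongrightarrow> D u"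
      using \<xi>(3) bounded_linear.tendsto[OF lin] by blast
    ultimately have "(\<lambda>k. t k *\<^sub>R (f (\<xi> k) - D (\<xi> k)) + D (t k *\<^sub>R \<xi> k)) \<longlonglongrightarrow> 0 + D u"
      by (rule tendsto_add)
    then show ?thesis using lin by (simp add: linear_simps algebra_simps)
  qed
  have scaled: "\<And>k. inverse (real (Suc k)) *\<^sub>R v \<in> range P" "(\<lambda>k. inverse (real (Suc k)) *\<^sub>R v) \<longlonglongrightarrow> 0"
    "(\<lambda>k. real (Suc k) *\<^sub>R f (inverse (real (Suc k)) *\<^sub>R v)) \<longlonglongrightarrow> D v" if "v \<in> range P" for v
  proof -
    show 1: "inverse (real (Suc k)) *\<^sub>R v \<in> range P" for k
      using that subspace_scale subspace_range_blinfun by blast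
    show 2: "(\<lambda>k. inverse (real (Suc k)) *\<^sub>R v) \<longlonglongrightarrow> 0"
      using tendsto_scaleR[OF LIMSEQ_inverse_real_of_nat tendsto_const[of v]] by simp
    show "(\<lambda>k. real (Suc k) *\<^sub>R f (inverse (real (Suc k)) *\<^sub>R v)) \<longlonglongrightarrow> D v"
      by (rule lim[OF 1 2]) simp_all
  qed
  \<comment> \<open>\<open>D v\<close> is a limit of multiples of values of f, all of which lie in
    the closed kernel of P.\<close>
  show "P (D v) = 0" if "v \<in> range P" for v
  proof -
    have "(\<lambda>k. P (real (Suc k) *\<^sub>R f (inverse (real (Suc k)) *\<^sub>R v))) \<longlonglongrightarrow> P (D v)"
      using scaled(3)[OF that] by (intro tendsto_intros) 
    moreover have "P (real (Suc k) *\<^sub>R f (inverse (real (Suc k)) *\<^sub>R v)) = 0" for k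
      using f[OF scaled(1)[OF that]] by (simp only: blinfun.scaleR_right scaleR_zero_right)
    ultimately show ?thesis by (simp add: LIMSEQ_const_iff)
  qed
  show "tangent_space \<Sigma> x = (\<lambda>v. v + D v) ` range P"
  proof (intro subset_antisym subsetI)
    fix v assume "v \<in> tangent_space \<Sigma> x"
    then obtain y t where y: "\<And>k. y k \<in> \<Sigma>" "y \<longlonglongrightarrow> x" "\<And>k. t k \<ge> 0" "(\<lambda>k. t k *\<^sub>R (y k - x)) \<longlonglongrightarrow> v"
      by (auto simp: tangent_space_def)
    define \<xi> where "\<xi> k = P (y k - x)" for k
    have "eventually (\<lambda>k. y k \<in> ball x r) sequentially"
      using tendstoD[OF y(2) \<open>r > 0\<close>] by (simp add: dist_commute)
    then have ev: "eventually (\<lambda>k. t k *\<^sub>R (y k - x) = t k *\<^sub>R \<xi> k + t k *\<^sub>R f (\<xi> k)) sequentially"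
    proof eventually_elim
      case (elim k)
      then have "y k = x + \<xi> k + f (\<xi> k)" using param[OF y(1) elim] unfolding \<xi>_def by metis
      then show ?case by (metis add.assoc add_diff_cancel_left' scaleR_add_right)
    qed
    have "(\<lambda>k. P (y k - x)) \<longlonglongrightarrow> P (x - x)" by (intro tendsto_intros y)
    then have \<xi>0: "\<xi> \<longlonglongrightarrow> 0" by (simp add: \<xi>_def[abs_def] blinfun.zero_right)
    have "(\<lambda>k. P (t k *\<^sub>R (y k - x))) \<longlonglongrightarrow> P v" by (intro tendsto_intros y)
    then have t\<xi>: "(\<lambda>k. t k *\<^sub>R \<xi> k) \<longlonglongrightarrow> P v" by (simp add: \<xi>_def blinfun.scaleR_right)
    have "(\<lambda>k. t k *\<^sub>R f (\<xi> k)) \<longlonglongrightarrow> D (P v)" by (rule lim[OF _ \<xi>0 t\<xi> y(3)]) (simp add: \<xi>_def)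
    with t\<xi> have "(\<lambda>k. t k *\<^sub>R \<xi> k + t k *\<^sub>R f (\<xi> k)) \<longlonglongrightarrow> P v + D (P v)" by (rule tendsto_add)
    then have "(\<lambda>k. t k *\<^sub>R (y k - x)) \<longlonglongrightarrow> P v + D (P v)"
      using tendsto_cong[OF ev] by blast
    then have "v = P v + D (P v)" using y(4) LIMSEQ_unique by blast
    then show "v \<in> (\<lambda>v. v + D v) ` range P" by blast
  next
    fix w assume "w \<in> (\<lambda>v. v + D v) ` range P"
    then obtain v where v: "v \<in> range P" and w: "w = v + D v" by blast
    define \<xi> where "\<xi> k = inverse (real (Suc k)) *\<^sub>R v" for k
    note s = scaled[OF v, folded \<xi>_def]
    define y where "y k = x + (\<xi> k + f (\<xi> k))" for k
    have tl: "(\<lambda>k. real (Suc k) *\<^sub>R (y k - x)) \<longlonglongrightarrow> w"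
    proof -
      have "real (Suc k) *\<^sub>R \<xi> k = v" for k by (simp add: \<xi>_def)
      then have "real (Suc k) *\<^sub>R (y k - x) = v + real (Suc k) *\<^sub>R f (\<xi> k)" for k
        by (simp add: y_def scaleR_add_right del: of_nat_Suc)
      then show ?thesis using tendsto_add[OF tendsto_const s(3)] w by (simp del: of_nat_Suc)
    qed
    have "(\<lambda>k. inverse (real (Suc k)) *\<^sub>R (real (Suc k) *\<^sub>R (y k - x))) \<longlonglongrightarrow> 0 *\<^sub>R w"
      by (intro tendsto_scaleR tl LIMSEQ_inverse_real_of_nat)
    moreover have "inverse (real (Suc k)) *\<^sub>R (real (Suc k) *\<^sub>R (y k - x)) = y k - x" for k by simp
    ultimately have "(\<lambda>k. y k - x) \<longlonglongrightarrow> 0" by (simp only: scaleR_zero_left)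
    then have yx: "y \<longlonglongrightarrow> x" by (simp add: LIM_zero_iff)
    then have "eventually (\<lambda>k. y k \<in> ball x r) sequentially"
      using tendstoD[OF _ \<open>r > 0\<close>] by (simp add: dist_commute)
    then obtain N where N: "\<And>k. k \<ge> N \<Longrightarrow> y k \<in> ball x r" by (auto simp: eventually_sequentially)
    \<comment> \<open>The definition of the cone wants every \<open>y k\<close> in the set, not just
      almost all of them, hence the shift by N.\<close>
    have "y (k + N) \<in> \<Sigma>" for k
    proof -
      have "y (k + N) \<in> (+) x ` graph_over (range P) f"
        unfolding y_def graph_over_def using s(1) by blast
      then show ?thesis using N[of "k + N"] eq by auto
    qed
    moreover have "(\<lambda>k. y (k + N)) \<longlonglongrightarrow> x" using yx by (rule LIMSEQ_ignore_initial_segment)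
    moreover have "(\<lambda>k. real (Suc (k + N)) *\<^sub>R (y (k + N) - x)) \<longlonglongrightarrow> w"
      using LIMSEQ_ignore_initial_segment[OF tl, of N] .
    ultimately show "w \<in> tangent_space \<Sigma> x"
      unfolding tangent_space_def mem_Collect_eq
      by (intro exI[of _ "\<lambda>k. y (k + N)"] exI[of _ "\<lambda>k. real (Suc (k + N))"]) auto
  qed
qed

text \<open>The differential takes values in the kernel of P, so P undoes the map
  \<open>v + Df 0 v\<close> on T; the cone is an injective linear image of T.\<close>

lemma C1a_submanifold_tangent_space:
  fixes \<Sigma> :: "'a::euclidean_space set"
  assumes "C1a_submanifold m \<alpha> \<Sigma>" "x \<in> \<Sigma>"
  shows "subspace (tangent_space \<Sigma> x)" "dim (tangent_space \<Sigma> x) = m"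
proof -
  obtain T r f Df where T: "subspace T" "dim T = m" "r > 0" "C1a_on T \<alpha> f Df"
    "\<Sigma> \<inter> ball x r = ((+) x ` graph_over T f) \<inter> ball x r"
    using assms by (auto simp: C1a_submanifold_def) 
  obtain P where P: "oproj P" "range (blinfun_apply P) = T" using oproj_exists[OF T(1)] .
  have 0: "0 \<in> T" using T(1) by (rule subspace_0)
  have f: "P (f \<xi>) = 0" if "\<xi> \<in> range P" for \<xi>
    using T(4) that P orthogonal_comp_oproj_iff[OF P(1)] by (auto simp: C1a_on_def)
  have D: "(f has_derivative Df 0) (at 0 within range P)"
    using T(4) 0 P by (auto simp: C1a_on_def)
  note tg = tangent_space_graph[OF P(1) assms(2) T(3) f D T(5)[folded P(2)]]
  define h where "h v = v + Df 0 v" for v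
  have lin: "linear h" unfolding h_def
    using has_derivative_bounded_linear[OF D] bounded_linear.linear linear_compose_add linear_ident by blast
  have ts: "tangent_space \<Sigma> x = h ` T" using tg(3) P(2) by (simp add: h_def)
  show "subspace (tangent_space \<Sigma> x)" unfolding ts using lin T(1) by (rule linear_subspace_image)
  have "inj_on h T"
  proof (rule linear_inj_on_iff_eq_0[THEN iffD2, rule_format, OF lin T(1)])
    fix v assume v: "v \<in> T" "h v = 0"
    have "P (Df 0 v) = 0" "P v = v" using tg(2)[of v] P oproj_range_iff[OF P(1), of v] v(1) by blast+
    then have "P (h v) = v" by (simp add: h_def blinfun.add_right)
    then show "v = 0" using v(2) by (simp add: blinfun.zero_right)
  qed
  then show "dim (tangent_space \<Sigma> x) = m"
    unfolding ts using lin T(1,2) by (metis dim_image_eq span_eq_iff)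
qed

text \<open>A chart in the sense of condition (ii), (iii), extended to the whole space: for \<open>f\<close> on
\<open>T = range P\<close>, \<open>g z = f (P z)\<close> and \<open>A z = Df (P z) \<circ> P\<close>.\<close>
definition C1a_chart ::
  "real \<Rightarrow> real \<Rightarrow> real \<Rightarrow> 'a::euclidean_space set \<Rightarrow> 'a \<Rightarrow> ('a \<Rightarrow>\<^sub>L 'a) \<Rightarrow> ('a \<Rightarrow> 'a) \<Rightarrow> ('a \<Rightarrow> 'a \<Rightarrow>\<^sub>L 'a) \<Rightarrow> bool"
  where
  "C1a_chart \<alpha> L R \<Sigma> x P g A \<longleftrightarrow>
     oproj P \<and> (\<forall>z. g (P z) = g z) \<and> (\<forall>z. P (g z) = 0) \<and> g 0 = 0 \<and> A 0 = 0 \<and>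
     (\<forall>z w. norm (g z - g w) \<le> norm (z - w)) \<and>
     (\<forall>z w. norm (A z - A w) \<le> L * norm (z - w) powr \<alpha>) \<and>
     (\<forall>z w. norm (g w - g z - A z (w - z)) \<le> L * norm (w - z) powr (1 + \<alpha>)) \<and>
     \<Sigma> \<inter> ball x R = ((+) x ` range (\<lambda>z. P z + g z)) \<inter> ball x R"

lemma C1a_chartD:
  assumes "C1a_chart \<alpha> L R \<Sigma> x P g A"
  shows C1a_chart_oproj: "oproj P" and C1a_chart_proj: "g (P z) = g z" and C1a_chart_normal: "P (g z) = 0"
    and C1a_chart_zero: "g 0 = 0" and C1a_chart_deriv_zero: "A 0 = 0"
    and C1a_chart_lipschitz: "norm (g z - g w) \<le> norm (z - w)"
    and C1a_chart_holder: "norm (A z - A w) \<le> L * norm (z - w) powr \<alpha>"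
    and C1a_chart_taylor: "norm (g w - g z - A z (w - z)) \<le> L * norm (w - z) powr (1 + \<alpha>)"
    and C1a_chart_graph: "\<Sigma> \<inter> ball x R = ((+) x ` range (\<lambda>z. P z + g z)) \<inter> ball x R"
  using assms by (auto simp: C1a_chart_def)

section \<open>First-order expansions and charts\<close>

text \<open>Expand at z + t v, divide by t and let t tend to 0: the remainder contributes only a
  multiple of \<open>t powr \<alpha>\<close>. This supplies the bound 1 on the derivatives of a
  chart, which is not itself among the chart conditions.\<close>

lemma norm_le_of_lipschitz_taylor:
  fixes g :: "'a::real_normed_vector \<Rightarrow> 'b::real_normed_vector" and A :: "'a \<Rightarrow>\<^sub>L 'b"
  assumes "\<alpha> > 0" and lip: "\<And>w. norm (g w - g z) \<le> norm (w - z)"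
    and taylor: "\<And>w. norm (g w - g z - A (w - z)) \<le> L * norm (w - z) powr (1 + \<alpha>)"
  shows "norm A \<le> 1"
proof (rule norm_blinfun_bound)
  fix v
  have bd: "norm (A v) \<le> norm v + L * norm v powr (1 + \<alpha>) * t powr \<alpha>" if "t > 0" for t
  proof -
    have "t * norm (A v) = norm (A (t *\<^sub>R v))" using that by (simp add: blinfun.scaleR_right)
    also have "\<dots> \<le> norm (g (z + t *\<^sub>R v) - g z) + norm (g (z + t *\<^sub>R v) - g z - A (t *\<^sub>R v))"
      by norm
    also have "\<dots> \<le> norm (t *\<^sub>R v) + L * norm (t *\<^sub>R v) powr (1 + \<alpha>)"
      using lip[of "z + t *\<^sub>R v"] taylor[of "z + t *\<^sub>R v"] by simp
    also have "\<dots> = t * (norm v + L * norm v powr (1 + \<alpha>) * t powr \<alpha>)"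
      using that by (simp add: powr_mult powr_add algebra_simps)
    finally show ?thesis using that by simp
  qed
  have "(\<lambda>n. norm v + L * norm v powr (1 + \<alpha>) * inverse (real (Suc n)) powr \<alpha>) \<longlonglongrightarrow> norm v + L * norm v powr (1 + \<alpha>) * 0"
    by (intro tendsto_intros tendsto_zero_powrI[of _ _ _ \<alpha>] LIMSEQ_inverse_real_of_nat) (auto simp: \<open>\<alpha> > 0\<close>)
  then have "norm (A v) \<le> norm v + L * norm v powr (1 + \<alpha>) * 0"
    by (rule LIMSEQ_le_const) (auto intro!: bd)
  then show "norm (A v) \<le> 1 * norm v" by simp
qed simp

lemma C1a_chart_deriv_le:
  assumes "C1a_chart \<alpha> L R \<Sigma> x P g A" "\<alpha> > 0"
  shows "norm (A z) \<le> 1"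
  by (rule norm_le_of_lipschitz_taylor[OF assms(2) C1a_chart_lipschitz[OF assms(1)] C1a_chart_taylor[OF assms(1)]])

text \<open>Only increments of length at most 1 are asked for, because products with a cutoff are
  controlled no further.\<close>

lemma has_derivative_of_taylor:
  assumes "\<alpha> > 0" "bounded_linear D"
    and "\<And>w. w \<in> T \<Longrightarrow> norm (w - z) \<le> 1 \<Longrightarrow> norm (f w - f z - D (w - z)) \<le> C * norm (w - z) powr (1 + \<alpha>)"
  shows "(f has_derivative D) (at z within T)"
proof (rule has_derivativeI_sandwich[of 1])
  fix y assume y: "y \<in> T" "y \<noteq> z" "dist y z < 1"
  then have "norm (f y - f z - D (y - z)) \<le> C * norm (y - z) powr (1 + \<alpha>)"
    by (intro assms) (auto simp: dist_norm)
  also have "\<dots> = (C * norm (y - z) powr \<alpha>) * norm (y - z)" using y by (simp add: powr_add)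
  finally show "norm (f y - f z - D (y - z)) / norm (y - z) \<le> C * norm (y - z) powr \<alpha>"
    using y by (simp add: pos_divide_le_eq)
next
  have "((\<lambda>y. C * norm (y - z) powr \<alpha>) \<longlongrightarrow> C * 0) (at z within T)"
    by (intro tendsto_intros tendsto_zero_powrI[of _ _ _ \<alpha>] tendsto_norm_zero LIM_zero)
      (auto simp: \<open>\<alpha> > 0\<close>)
  then show "((\<lambda>y. C * norm (y - z) powr \<alpha>) \<longlongrightarrow> 0) (at z within T)" by simp
qed (use assms in auto)

text \<open>Linearized mean value inequality on the ball about z that reaches w: there the
  derivative differs from \<open>A z\<close> by at most
  \<open>L * norm (w - z) powr \<alpha>\<close>.\<close>

lemma taylor_of_holder_derivative:
  fixes g :: "'a::real_normed_vector \<Rightarrow> 'b::real_normed_vector" and A :: "'a \<Rightarrow> 'a \<Rightarrow>\<^sub>L 'b"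
  assumes "0 \<le> L" "\<alpha> > 0" and D: "\<And>z. (g has_derivative A z) (at z)"
    and H: "\<And>z w. norm (A z - A w) \<le> L * norm (z - w) powr \<alpha>"
  shows "norm (g w - g z - A z (w - z)) \<le> L * norm (w - z) powr (1 + \<alpha>)"
proof -
  let ?S = "cball z (norm (w - z))"
  have "norm (g w - g z - A z (w - z)) \<le> norm (w - z) * (L * norm (w - z) powr \<alpha>)"
  proof (rule differentiable_bound_linearization[where S = ?S and f' = "\<lambda>x. blinfun_apply (A x)"])
    fix t :: real assume "t \<in> {0..1}"
    then show "z + t *\<^sub>R (w - z) \<in> ?S" by (simp add: dist_norm mult_left_le_one_le)
  next
    fix x assume x: "x \<in> ?S"
    show "(g has_derivative A x) (at x within ?S)" using D has_derivative_at_withinI by blast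
    have "onorm (blinfun_apply (A x) - blinfun_apply (A z)) = norm (A x - A z)"
      by (simp add: norm_blinfun.rep_eq fun_diff_def blinfun.diff_left[symmetric])
    also have "\<dots> \<le> L * norm (x - z) powr \<alpha>" by (rule H)
    also have "\<dots> \<le> L * norm (w - z) powr \<alpha>"
      using x assms by (intro mult_left_mono powr_mono2) (auto simp: dist_norm norm_minus_commute)
    finally show "onorm (blinfun_apply (A x) - blinfun_apply (A z)) \<le> L * norm (w - z) powr \<alpha>" .
  qed simp
  also have "\<dots> = L * norm (w - z) powr (1 + \<alpha>)"
    by (cases "w = z") (auto simp: powr_add)
  finally show ?thesis .
qed

text \<open>Composition with P leaves all constants of the class intact, because P is
  1-Lipschitz.\<close>

lemma C1a_class_RLd_chart:
  fixes \<Sigma> :: "'a::euclidean_space set"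
  assumes cl: "C1a_class_RLd m \<alpha> R L d \<Sigma>" and x: "x \<in> \<Sigma>" and \<alpha>: "\<alpha> > 0" and L: "L \<ge> 0"
  obtains P g A where "C1a_chart \<alpha> L R \<Sigma> x P g A" "range (blinfun_apply P) = tangent_space \<Sigma> x"
    "dim (range (blinfun_apply P)) = m"
proof -
  let ?T = "tangent_space \<Sigma> x"
  have sm: "C1a_submanifold m \<alpha> \<Sigma>" using cl by (simp add: C1a_class_RLd_def C1a_class_def)
  note T = C1a_submanifold_tangent_space[OF sm x]
  obtain P where P: "oproj P" "range (blinfun_apply P) = ?T" using oproj_exists[OF T(1)] .
  obtain f Df where f: "C1a_on ?T \<alpha> f Df"
    and gr: "\<Sigma> \<inter> ball x R = ((+) x ` graph_over ?T f) \<inter> ball x R"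
    and f0: "f 0 = 0" and Df0: "\<forall>v\<in>?T. Df 0 v = 0"
    and hol0: "\<forall>\<xi>\<in>?T. \<forall>\<eta>\<in>?T. \<forall>v\<in>?T. norm (Df \<xi> v - Df \<eta> v) \<le> L * norm (\<xi> - \<eta>) powr \<alpha> * norm v"
    and lip0: "\<forall>\<xi>\<in>?T. \<forall>\<eta>\<in>?T. norm (f \<xi> - f \<eta>) \<le> norm (\<xi> - \<eta>)"
    using cl[unfolded C1a_class_RLd_def, THEN conjunct2, THEN conjunct2, THEN bspec, OF x]
    by (elim exE conjE)
  note hol = hol0[rule_format] and lip = lip0[rule_format]
  have PT: "P z \<in> ?T" for z using P by blast
  define g where "g z = f (P z)" for z
  \<comment> \<open>A derivative within T is bounded linear on the whole space, but its values off T
    are arbitrary; composing with P evaluates it on tangent vectors only.\<close>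
  define A where "A z = Blinfun (Df (P z)) o\<^sub>L P" for z
  have Dl: "(f has_derivative Df (P z)) (at (P z) within ?T)" for z
    using f PT by (auto simp: C1a_on_def)
  have Aap: "A z v = Df (P z) (P v)" for z v
    by (simp add: A_def bounded_linear_Blinfun_apply[OF has_derivative_bounded_linear[OF Dl]])
  have Pd: "norm (P z - P w) \<le> norm (z - w)" for z w
    by (metis P(1) blinfun.diff_right oproj_norm_le)
  have D: "(g has_derivative A z) (at z)" for z
  proof -
    have "(P has_derivative P) (at z)" by (rule bounded_linear_imp_has_derivative[OF blinfun.bounded_linear_right])
    from has_derivative_in_compose[OF this, of f "Df (P z)"] Dl[of z] P(2)
    show ?thesis by (simp add: g_def[abs_def] Aap[abs_def])
  qed
  have H: "norm (A z - A w) \<le> L * norm (z - w) powr \<alpha>" for z w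
  proof (rule norm_blinfun_bound)
    fix v
    have "norm ((A z - A w) v) \<le> L * norm (P z - P w) powr \<alpha> * norm (P v)"
      using hol[OF PT PT PT] by (simp add: blinfun.diff_left Aap)
    also have "\<dots> \<le> L * norm (z - w) powr \<alpha> * norm v"
      using L \<alpha> Pd oproj_norm_le[OF P(1)] by (intro mult_mono powr_mono2) auto
    finally show "norm ((A z - A w) v) \<le> L * norm (z - w) powr \<alpha> * norm v" .
  qed (use L in auto)
  have "C1a_chart \<alpha> L R \<Sigma> x P g A"
    unfolding C1a_chart_def
  proof (intro conjI allI P(1) H taylor_of_holder_derivative[OF L \<alpha> D H])
    show "g (P z) = g z" for z by (simp add: g_def oproj_idem[OF P(1)])
    show "P (g z) = 0" for z
      using f PT[of z] orthogonal_comp_oproj_iff[OF P(1), of "f (P z)"] P(2) by (auto simp: C1a_on_def g_def)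
    show "g 0 = 0" by (simp add: g_def f0 blinfun.zero_right)
    show "A 0 = 0" using Df0 PT by (intro blinfun_eqI) (simp add: Aap blinfun.zero_right)
    show "norm (g z - g w) \<le> norm (z - w)" for z w
      unfolding g_def using lip[OF PT PT] Pd order_trans by blast
    have "graph_over ?T f = range (\<lambda>z. P z + g z)"
      unfolding graph_over_def P(2)[symmetric] by (simp add: image_image g_def)
    then show "\<Sigma> \<inter> ball x R = ((+) x ` range (\<lambda>z. P z + g z)) \<inter> ball x R" using gr by simp
  qed
  then show thesis using that P(2) T(2) by simp
qed

lemma C1a_chart_graph_over:
  assumes "C1a_chart \<alpha> L R \<Sigma> x P g A"
  shows "\<Sigma> \<inter> ball x R = ((+) x ` graph_over (range P) g) \<inter> ball x R"
proof -
  have "graph_over (range P) g = range (\<lambda>z. P z + g z)"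
    unfolding graph_over_def by (simp add: image_image C1a_chart_proj[OF assms])
  then show ?thesis using C1a_chart_graph[OF assms] by simp
qed

lemma C1a_chart_C1a_on:
  assumes ch: "C1a_chart \<alpha> L R \<Sigma> x P g A" and \<alpha>: "\<alpha> > 0"
  shows "C1a_on (range P) \<alpha> g (\<lambda>\<xi>. blinfun_apply (A \<xi>))"
  unfolding C1a_on_def
proof (intro conjI ballI allI impI)
  fix \<xi> :: 'a
  show "g \<xi> \<in> orthogonal_comp (range P)"
    using orthogonal_comp_oproj_iff[OF C1a_chart_oproj[OF ch]] C1a_chart_normal[OF ch] by blast
  show "(g has_derivative A \<xi>) (at \<xi> within range P)"
    by (rule has_derivative_of_taylor[OF \<alpha> blinfun.bounded_linear_right C1a_chart_taylor[OF ch]])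
next
  fix r :: real
  have "norm (A \<xi> v - A \<eta> v) \<le> L * norm (\<xi> - \<eta>) powr \<alpha> * norm v" for \<xi> \<eta> v
    using norm_blinfun[of "A \<xi> - A \<eta>" v] mult_right_mono[OF C1a_chart_holder[OF ch, of \<xi> \<eta>], of "norm v"]
    by (simp add: blinfun.diff_left)
  then show "\<exists>C. \<forall>\<xi>\<in>range P. \<forall>\<eta>\<in>range P. norm \<xi> \<le> r \<longrightarrow> norm \<eta> \<le> r \<longrightarrow>
        (\<forall>v\<in>range P. norm (A \<xi> v - A \<eta> v) \<le> C * norm (\<xi> - \<eta>) powr \<alpha> * norm v)" by blast
qed

text \<open>With \<open>A 0 = 0\<close> the graph of the differential is the plane itself. This
  links the plane of a chart to the cone in terms of which the class and the convergence are
  defined.\<close>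

lemma C1a_chart_tangent_space:
  assumes ch: "C1a_chart \<alpha> L R \<Sigma> x P g A" and \<alpha>: "\<alpha> > 0" and "R > 0" "x \<in> \<Sigma>"
  shows "tangent_space \<Sigma> x = range P"
proof -
  have "(g has_derivative A 0) (at 0 within range P)"
    by (rule has_derivative_of_taylor[OF \<alpha> blinfun.bounded_linear_right C1a_chart_taylor[OF ch]])
  from tangent_space_graph(3)[OF C1a_chart_oproj[OF ch] assms(4,3) _ this C1a_chart_graph_over[OF ch]]
  show ?thesis by (simp add: C1a_chart_normal[OF ch] C1a_chart_deriv_zero[OF ch])
qed

lemma C1a_class_RLd_of_charts:
  fixes \<Sigma> :: "'a::euclidean_space set"
  assumes "compact \<Sigma>" "\<Sigma> \<subseteq> cball 0 d" "\<alpha> > 0" "R > 0"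
    and ch: "\<And>x. x \<in> \<Sigma> \<Longrightarrow> \<exists>P g A. C1a_chart \<alpha> L R \<Sigma> x P g A \<and> dim (range (blinfun_apply P)) = m"
  shows "C1a_class_RLd m \<alpha> R L d \<Sigma>"
  unfolding C1a_class_RLd_def C1a_class_def C1a_submanifold_def
proof (intro conjI ballI assms(1,2))
  fix x assume x: "x \<in> \<Sigma>"
  obtain P g A where c: "C1a_chart \<alpha> L R \<Sigma> x P g A" "dim (range (blinfun_apply P)) = m" using ch[OF x] by blast
  show "\<exists>T r f Df. subspace T \<and> dim T = m \<and> r > 0 \<and> C1a_on T \<alpha> f Df \<and>
        \<Sigma> \<inter> ball x r = ((+) x ` graph_over T f) \<inter> ball x r"
    using subspace_range_blinfun c(2) C1a_chart_C1a_on[OF c(1)] C1a_chart_graph_over[OF c(1)] assms(3,4) by blast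
next
  fix x assume x: "x \<in> \<Sigma>"
  obtain P g A where c: "C1a_chart \<alpha> L R \<Sigma> x P g A" using ch[OF x] by blast
  have hol: "norm (A \<xi> v - A \<eta> v) \<le> L * norm (\<xi> - \<eta>) powr \<alpha> * norm v" for \<xi> \<eta> v
    using norm_blinfun[of "A \<xi> - A \<eta>" v] mult_right_mono[OF C1a_chart_holder[OF c, of \<xi> \<eta>], of "norm v"]
    by (simp add: blinfun.diff_left)
  show "\<exists>f Df.
        C1a_on (tangent_space \<Sigma> x) \<alpha> f Df \<and>
        \<Sigma> \<inter> ball x R = ((+) x ` graph_over (tangent_space \<Sigma> x) f) \<inter> ball x R \<and>
        f 0 = 0 \<and> (\<forall>v\<in>tangent_space \<Sigma> x. Df 0 v = 0) \<and>
        (\<forall>\<xi>\<in>tangent_space \<Sigma> x. \<forall>\<eta>\<in>tangent_space \<Sigma> x. \<forall>v\<in>tangent_space \<Sigma> x.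
            norm (Df \<xi> v - Df \<eta> v) \<le> L * norm (\<xi> - \<eta>) powr \<alpha> * norm v) \<and>
        (\<forall>\<xi>\<in>tangent_space \<Sigma> x. \<forall>\<eta>\<in>tangent_space \<Sigma> x.
            norm (f \<xi> - f \<eta>) \<le> norm (\<xi> - \<eta>))"
    unfolding C1a_chart_tangent_space[OF c assms(3,4) x]
    by (intro exI[of _ g] exI[of _ "\<lambda>\<xi>. blinfun_apply (A \<xi>)"] conjI C1a_chart_C1a_on[OF c assms(3)]
        C1a_chart_graph_over[OF c])
      (use hol in \<open>auto simp: C1a_chart_zero[OF c] C1a_chart_deriv_zero[OF c] C1a_chart_lipschitz[OF c]\<close>)
qed

section \<open>Compactness\<close>

text \<open>The distance functions of the sets are 1-Lipschitz, so Arzela-Ascoli gives a uniform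
  limit \<open>g\<close> on the ball; the limit set is the zero set of \<open>g\<close>.\<close>

lemma blaschke_selection:
  fixes S :: "nat \<Rightarrow> 'a::euclidean_space set"
  assumes ne: "\<And>j. S j \<noteq> {}" and sub: "\<And>j. S j \<subseteq> cball 0 d"
  obtains r S0 where "strict_mono r" "compact S0" "S0 \<subseteq> cball 0 d" "hausdorff_conv (S \<circ> r) S0"
proof -
  define u where "u j z = infdist z (S j)" for j z
  have bd: "norm (u j z) \<le> 2 * d" if z: "z \<in> cball 0 d" for j z
  proof -
    obtain y where y: "y \<in> S j" using ne by blast
    have "infdist z (S j) \<le> dist z y" using y by (rule infdist_le)
    also have "\<dots> \<le> norm z + norm y" by (simp add: dist_norm norm_triangle_ineq4)
    also have "\<dots> \<le> 2 * d" using z y sub[of j] by auto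
    finally show ?thesis by (simp add: u_def infdist_nonneg)
  qed
  have lip: "norm (u j z - u j w) \<le> norm (z - w)" for j z w
    using infdist_triangle[of z "S j" w] infdist_triangle[of w "S j" z]
    by (simp add: u_def dist_norm norm_minus_commute abs_le_iff)
  have eq: "\<exists>\<delta>>0. \<forall>n y. y \<in> cball 0 d \<and> norm (z - y) < \<delta> \<longrightarrow> norm (u n z - u n y) < e" if "e > 0" for z e
    using that lip le_less_trans by blast
  obtain g r where g: "continuous_on (cball 0 d) g" and r: "strict_mono (r :: nat \<Rightarrow> nat)"
    and conv: "\<And>e. 0 < e \<Longrightarrow> \<exists>N. \<forall>n x. n \<ge> N \<and> x \<in> cball 0 d \<longrightarrow> norm (u (r n) x - g x) < e"
    by (rule Arzela_Ascoli[OF compact_cball[of 0 d] bd eq]) blast+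
  have g0: "g z \<ge> 0" if z: "z \<in> cball 0 d" for z
  proof (rule ccontr)
    assume "\<not> g z \<ge> 0"
    then obtain N where "norm (u (r N) z - g z) < - g z" using conv[of "- g z"] z by force
    moreover have "u (r N) z \<ge> 0" by (simp add: u_def infdist_nonneg)
    ultimately show False by auto
  qed
  define S0 where "S0 = {z \<in> cball 0 d. g z = 0}"
  have sub0: "S0 \<subseteq> cball 0 d" by (auto simp: S0_def)
  have "closed S0" unfolding S0_def by (rule continuous_closed_preimage_constant[OF g closed_cball])
  then have cpt: "compact S0" using sub0 bounded_cball bounded_subset compact_eq_bounded_closed by blast
  have "hausdorff_conv (S \<circ> r) S0"
    unfolding hausdorff_conv_def
  proof (intro allI impI)
    fix e :: real assume "e > 0"
    \<comment> \<open>It is not known here that \<open>g\<close> is the distance to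
      \<open>S0\<close>. On the compact part of the ball outside the e-neighbourhood of
      \<open>S0\<close>, however, \<open>g\<close> is positive, and its minimum there serves as
      c.\<close>
    have "\<exists>c>0. \<forall>y\<in>cball 0 d. g y < c \<longrightarrow> (\<exists>z\<in>S0. dist y z < e)"
    proof -
      define K where "K = cball 0 d - (\<Union>z\<in>S0. ball z e)"
      show ?thesis
      proof (cases "K = {}")
        case True
        then have "cball 0 d \<subseteq> (\<Union>z\<in>S0. ball z e)" by (simp add: K_def)
        then have "\<forall>y\<in>cball 0 d. \<exists>z\<in>S0. dist z y < e" by (simp add: subset_iff)
        then have "\<forall>y\<in>cball 0 d. \<exists>z\<in>S0. dist y z < e" by (simp add: dist_commute)
        then show ?thesis by (intro exI[of _ 1]) auto
      next
        case False
        have "compact K" unfolding K_def by (intro compact_diff) auto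
        moreover have "continuous_on K g" using g by (rule continuous_on_subset) (auto simp: K_def)
        ultimately obtain y where y: "y \<in> K" "\<forall>w\<in>K. g y \<le> g w" using continuous_attains_inf[OF _ False] by blast
        have "g y \<noteq> 0" using y(1) \<open>e > 0\<close> by (auto simp: K_def S0_def)
        then have "g y > 0" using g0[of y] y(1) by (auto simp: K_def)
        moreover have "\<exists>z\<in>S0. dist w z < e" if "w \<in> cball 0 d" "g w < g y" for w
        proof -
          have "w \<notin> K" using y(2) that by force
          then show ?thesis using that by (auto simp: K_def dist_commute)
        qed
        ultimately show ?thesis by blast
      qed
    qed
    then obtain c where c: "c > 0" "\<And>y. y \<in> cball 0 d \<Longrightarrow> g y < c \<Longrightarrow> \<exists>z\<in>S0. dist y z < e" by blast
    \<comment> \<open>The bound c forces points of the sets to be near \<open>S0\<close>; the bound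
      e is for the opposite direction, where \<open>g\<close> vanishes at the given point.\<close>
    obtain N where N: "\<And>n x. n \<ge> N \<Longrightarrow> x \<in> cball 0 d \<Longrightarrow> norm (u (r n) x - g x) < min c e"
      using conv[of "min c e"] c(1) \<open>e > 0\<close> by auto
    show "eventually (\<lambda>j. (\<forall>y\<in>(S \<circ> r) j. \<exists>z\<in>S0. dist y z < e) \<and> (\<forall>z\<in>S0. \<exists>y\<in>(S \<circ> r) j. dist z y < e)) sequentially"
      unfolding eventually_sequentially
    proof (intro exI[of _ N] allI impI conjI ballI)
      fix n y assume n: "n \<ge> N" and y: "y \<in> (S \<circ> r) n"
      have yd: "y \<in> cball 0 d" using y sub[of "r n"] by auto
      have "u (r n) y = 0" using y by (simp add: u_def)
      then have "g y < c" using N[OF n yd] by auto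
      then show "\<exists>z\<in>S0. dist y z < e" using c(2) yd by blast
    next
      fix n z assume n: "n \<ge> N" and z: "z \<in> S0"
      have "infdist z (S (r n)) < e" using N[OF n, of z] z by (auto simp: S0_def u_def)
      then have "(INF y\<in>S (r n). dist z y) < e" using ne[of "r n"] by (simp add: infdist_def)
      then show "\<exists>y\<in>(S \<circ> r) n. dist z y < e"
        using cInf_lessD[of "dist z ` S (r n)" e] ne[of "r n"] by auto
    qed
  qed
  then show thesis using that r cpt sub0 by blast
qed

section \<open>Pointwise limits of charts\<close>

text \<open>A diagonal argument gives convergence on a countable dense set, and the common modulus
  of continuity carries the Cauchy property to every point. The bound depends on the point because
  charts may grow linearly.\<close>

lemma pointwise_convergent_subsequence:
  fixes u :: "nat \<Rightarrow> 'a::euclidean_space \<Rightarrow> 'b::{real_normed_vector,heine_borel}"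
  assumes bd: "\<And>n z. norm (u n z) \<le> M z"
    and modulus: "\<And>n z w. norm (u n z - u n w) \<le> \<omega> (norm (z - w))" and lim: "(\<omega> \<longlongrightarrow> 0) (at_right 0)"
  obtains k g where "strict_mono (k :: nat \<Rightarrow> nat)" "\<And>z. (\<lambda>n. u (k n) z) \<longlonglongrightarrow> g z"
proof -
  obtain D :: "'a set" where D: "countable D" "\<And>X. open X \<Longrightarrow> X \<noteq> {} \<Longrightarrow> \<exists>d\<in>D. d \<in> X"
    using countable_dense_exists by blast
  \<comment> \<open>The diagonal extraction asks for one bound valid at all points; this rescaling
    provides it and is undone afterwards point by point.\<close>
  define v where "v n z = (1 / (1 + \<bar>M z\<bar>)) *\<^sub>R u n z" for n z
  have "norm (v n z) \<le> 1" for n z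
    using bd[of n z] by (simp add: v_def field_simps)
  then obtain k where k: "strict_mono (k :: nat \<Rightarrow> nat)" "\<And>z. z \<in> D \<Longrightarrow> \<exists>l. (\<lambda>n. v (k n) z) \<longlonglongrightarrow> l"
    using function_convergent_subsequence[OF D(1)] by metis
  have convD: "convergent (\<lambda>n. u (k n) z)" if z: "z \<in> D" for z
  proof -
    obtain l where l: "(\<lambda>n. v (k n) z) \<longlonglongrightarrow> l" using k(2)[OF z] by blast
    have "1 + \<bar>M z\<bar> \<noteq> 0" by (metis abs_ge_zero add_nonneg_eq_0_iff zero_le_one zero_neq_one)
    then have eq: "u n z = (1 + \<bar>M z\<bar>) *\<^sub>R v n z" for n by (simp add: v_def)
    show ?thesis unfolding eq by (rule convergentI[OF tendsto_scaleR[OF tendsto_const l]])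
  qed
  have "convergent (\<lambda>n. u (k n) z)" for z
  proof (rule Cauchy_convergent, rule CauchyI)
    fix e :: real assume "e > 0"
    then have "eventually (\<lambda>t. \<omega> t < e / 3) (at_right 0)" using order_tendstoD(2)[OF lim, of "e/3"] by simp
    then obtain b where b: "b > 0" "\<And>t. 0 < t \<Longrightarrow> t < b \<Longrightarrow> \<omega> t < e / 3"
      by (auto simp: eventually_at_right_field)
    obtain w where w: "w \<in> D" "w \<in> ball z b" using D(2)[of "ball z b"] b(1) by auto
    have close: "norm (u n z - u n w) < e / 3" for n
    proof (cases "z = w")
      case False
      then have "\<omega> (norm (z - w)) < e / 3" using b(2) w(2) by (simp add: dist_norm)
      then show ?thesis using modulus[of n z w] by simp
    qed (use \<open>e > 0\<close> in simp)
    have "Cauchy (\<lambda>n. u (k n) w)" using convD[OF w(1)] by (rule convergent_Cauchy)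
    then obtain N where N: "\<And>m n. m \<ge> N \<Longrightarrow> n \<ge> N \<Longrightarrow> norm (u (k m) w - u (k n) w) < e / 3"
      using CauchyD[of "\<lambda>n. u (k n) w" "e/3"] \<open>e > 0\<close> by auto
    have "norm (u (k m) z - u (k n) z) < e" if "m \<ge> N" "n \<ge> N" for m n
      using N[OF that] close[of "k m"] close[of "k n"] by norm
    then show "\<exists>N. \<forall>m\<ge>N. \<forall>n\<ge>N. norm (u (k m) z - u (k n) z) < e" by blast
  qed
  then show thesis using that[OF k(1), of "\<lambda>z. lim (\<lambda>n. u (k n) z)"] convergent_LIMSEQ_iff by blast
qed

lemma hausdorff_conv_subseq:
  assumes "hausdorff_conv S S0" "strict_mono r" shows "hausdorff_conv (S \<circ> r) S0"
  unfolding hausdorff_conv_def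
proof (intro allI impI)
  fix e :: real assume "e > 0"
  from eventually_subseq[OF assms(2) assms(1)[unfolded hausdorff_conv_def, rule_format, OF this]]
  show "eventually (\<lambda>j. (\<forall>y\<in>(S \<circ> r) j. \<exists>z\<in>S0. dist y z < e) \<and> (\<forall>z\<in>S0. \<exists>y\<in>(S \<circ> r) j. dist z y < e)) sequentially"
    by simp
qed

lemma hausdorff_conv_approx:
  fixes S :: "nat \<Rightarrow> 'a::heine_borel set"
  assumes "hausdorff_conv S S0" "\<And>j. compact (S j)" "\<And>j. S j \<noteq> {}" "x \<in> S0"
  obtains y where "\<And>j. y j \<in> S j" "y \<longlonglongrightarrow> x"
proof -
  have "\<exists>y\<in>S j. infdist x (S j) = dist x y" for j
    using infdist_attains_inf[OF compact_imp_closed[OF assms(2)] assms(3)] by metis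
  then obtain y where y: "\<And>j. y j \<in> S j" "\<And>j. infdist x (S j) = dist x (y j)" by metis
  have "y \<longlonglongrightarrow> x"
  proof (rule tendstoI)
    fix e :: real assume "e > 0"
    from assms(1)[unfolded hausdorff_conv_def, rule_format, OF this]
    show "eventually (\<lambda>j. dist (y j) x < e) sequentially"
    proof eventually_elim
      case (elim j)
      then obtain z where "z \<in> S j" "dist x z < e" using assms(4) by blast
      then have "dist x (y j) < e" using infdist_le[of z "S j" x] y(2)[of j] by simp
      then show ?case by (simp add: dist_commute)
    qed
  qed
  then show thesis using that y(1) by blast
qed

lemma hausdorff_conv_limit_mem:
  assumes "hausdorff_conv S S0" "closed S0" "eventually (\<lambda>j. y j \<in> S j) sequentially" "y \<longlonglongrightarrow> x"
  shows "x \<in> S0"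
proof -
  have "\<exists>z\<in>S0. dist z x < e" if "e > 0" for e
  proof -
    have e2: "e / 2 > 0" using that by simp
    have "eventually (\<lambda>j. \<exists>z\<in>S0. dist z x < e) sequentially"
      using assms(1)[unfolded hausdorff_conv_def, rule_format, OF e2] assms(3) tendstoD[OF assms(4) e2]
    proof eventually_elim
      case (elim j)
      then obtain z where "z \<in> S0" "dist (y j) z < e / 2" by blast
      then show ?case using elim(3) dist_triangle_half_r by blast
    qed
    then show ?thesis by (auto simp: eventually_sequentially)
  qed
  then have "x \<in> closure S0" by (simp add: closure_approachable)
  then show ?thesis using assms(2) by simp
qed

text \<open>\<open>g\<close> is normal to the plane, so \<open>P (y - x)\<close> recovers the
  parameter of y; since \<open>g\<close> factors through P, the unprojected vector
  \<open>y - x\<close> can serve as its argument.\<close>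

lemma C1a_chart_param:
  assumes ch: "C1a_chart \<alpha> L R \<Sigma> x P g A" and y: "y \<in> \<Sigma>" "dist x y < R"
  shows "y = x + (P (y - x) + g (y - x))"
proof -
  have "y \<in> \<Sigma> \<inter> ball x R" using y by simp
  then obtain w where w: "y = x + (P w + g w)" unfolding C1a_chart_graph[OF ch] by blast
  have pw: "P (y - x) = P w"
    using w C1a_chart_normal[OF ch] oproj_idem[OF C1a_chart_oproj[OF ch]] by (simp add: blinfun.add_right)
  then have "g (y - x) = g w" using C1a_chart_proj[OF ch] by metis
  then show ?thesis using w pw by simp
qed

text \<open>Apart from the graph identity, the chart conditions are closed and pass to pointwise
  limits. For the graph identity it matters that the ball is open: points converging to a point of
  the limit ball eventually lie in the moving balls, where the identity for the approximating sets
  applies.\<close>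

lemma C1a_chart_limit:
  fixes S :: "nat \<Rightarrow> 'a::euclidean_space set"
  assumes \<alpha>: "\<alpha> > 0" and L: "L \<ge> 0"
    and ch: "\<And>j. C1a_chart \<alpha> L R (S j) (x j) (P j) (g j) (A j)"
    and dm: "\<And>j. dim (range (blinfun_apply (P j))) = m"
    and x: "x \<longlonglongrightarrow> x0" and hc: "hausdorff_conv S S0" and "closed S0"
    and cpt: "\<And>j. compact (S j)" and ne: "\<And>j. S j \<noteq> {}"
  shows "\<exists>P g A. C1a_chart \<alpha> L R S0 x0 P g A \<and> dim (range (blinfun_apply P)) = m"
proof -
  note c = C1a_chartD[OF ch]
  \<comment> \<open>Treating function, derivative and projection as one triple yields a single
    subsequence for all three. The projection is constant in z, so its limit can be read off at
    0.\<close>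
  define u where "u n z = (g n z, A n z, P n)" for n z
  have "norm (u n z) \<le> norm z + (1 + 1)" for n z
  proof -
    have "norm (g n z) \<le> norm z" using c(6)[of n z 0] c(4)[of n] by simp
    moreover have "norm (A n z) \<le> 1" using C1a_chart_deriv_le[OF ch \<alpha>] .
    moreover have "norm (P n) \<le> 1" using oproj_norm_blinfun_le c(1) by blast
    ultimately show ?thesis unfolding u_def
      by (meson norm_Pair_le add_mono order_trans)
  qed
  moreover have "norm (u n z - u n w) \<le> (\<lambda>t. t + L * t powr \<alpha>) (norm (z - w))" for n z w
  proof -
    have "norm (u n z - u n w) \<le> norm (g n z - g n w) + (norm (A n z - A n w) + norm (0::'a \<Rightarrow>\<^sub>L 'a))"
      unfolding u_def by (simp del: norm_zero) (meson norm_Pair_le add_left_mono order_trans)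
    then show ?thesis using c(6)[of n z w] c(7)[of n z w] by simp
  qed
  moreover have "((\<lambda>t. t + L * t powr \<alpha>) \<longlongrightarrow> 0) (at_right 0)"
  proof -
    have "((\<lambda>t. t + L * t powr \<alpha>) \<longlongrightarrow> 0 + L * 0) (at_right 0)"
      by (intro tendsto_intros tendsto_zero_powrI[of _ _ _ \<alpha>])
        (auto simp: \<alpha> eventually_at_right_field intro: exI[of _ 1])
    then show ?thesis by simp
  qed
  ultimately obtain k h where k: "strict_mono (k :: nat \<Rightarrow> nat)" and h: "\<And>z. (\<lambda>n. u (k n) z) \<longlonglongrightarrow> h z"
    by (rule pointwise_convergent_subsequence[of u]) blast
  define g' A' P' where "g' z = fst (h z)" and "A' z = fst (snd (h z))" and "P' = snd (snd (h 0))" for z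
  have lg: "(\<lambda>n. g (k n) z) \<longlonglongrightarrow> g' z" for z
    using tendsto_fst[OF h[of z]] by (simp add: u_def g'_def)
  have lA: "(\<lambda>n. A (k n) z) \<longlonglongrightarrow> A' z" for z
    using tendsto_fst[OF tendsto_snd[OF h[of z]]] by (simp add: u_def A'_def)
  have lP: "(\<lambda>n. P (k n)) \<longlonglongrightarrow> P'"
    using tendsto_snd[OF tendsto_snd[OF h[of 0]]] by (simp add: u_def P'_def)
  have lx: "(\<lambda>n. x (k n)) \<longlonglongrightarrow> x0" using LIMSEQ_subseq_LIMSEQ[OF x k] by (simp add: o_def)
  have lPz: "(\<lambda>n. P (k n) (z n)) \<longlonglongrightarrow> P' z0" if "z \<longlonglongrightarrow> z0" for z z0
    by (intro blinfun.tendsto lP that)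
  \<comment> \<open>The common Lipschitz bound upgrades pointwise convergence to convergence along
    moving arguments.\<close>
  have lgz: "(\<lambda>n. g (k n) (z n)) \<longlonglongrightarrow> g' z0" if "z \<longlonglongrightarrow> z0" for z z0
  proof -
    have "(\<lambda>n. norm (z n - z0)) \<longlonglongrightarrow> 0" using that by (simp add: LIM_zero tendsto_norm_zero)
    then have "(\<lambda>n. g (k n) (z n) - g (k n) z0) \<longlonglongrightarrow> 0"
      by (rule Lim_null_comparison[rotated]) (simp add: c(6))
    from tendsto_add[OF this lg[of z0]] show ?thesis by simp
  qed
  have P': "oproj P'"
    unfolding oproj_def
  proof (intro conjI allI)
    fix z w
    have "(\<lambda>n. P (k n) (P (k n) z)) \<longlonglongrightarrow> P' (P' z)" by (intro lPz tendsto_const)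
    moreover have "(\<lambda>n. P (k n) (P (k n) z)) \<longlonglongrightarrow> P' z"
      using lPz[OF tendsto_const] oproj_idem[OF c(1)] by simp
    ultimately show "P' (P' z) = P' z" by (rule LIMSEQ_unique)
    have "(\<lambda>n. P (k n) z \<bullet> w) \<longlonglongrightarrow> P' z \<bullet> w" by (intro tendsto_intros lPz)
    moreover have "(\<lambda>n. z \<bullet> P (k n) w) \<longlonglongrightarrow> z \<bullet> P' w" by (intro tendsto_intros lPz)
    ultimately show "P' z \<bullet> w = z \<bullet> P' w"
      using oproj_self_adjoint[OF c(1)] LIMSEQ_unique by force
  qed
  have gP': "g' (P' z) = g' z" for z
    using lgz[OF lPz[OF tendsto_const[of z]]] lg[of z] c(2) LIMSEQ_unique by force
  have Pg': "P' (g' z) = 0" for z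
    using lPz[OF lg[of z]] c(3) by (simp add: LIMSEQ_const_iff)
  have graph: "S0 \<inter> ball x0 R = ((+) x0 ` range (\<lambda>z. P' z + g' z)) \<inter> ball x0 R"
  proof (intro subset_antisym subsetI IntI; elim IntE)
    fix y assume y: "y \<in> S0" "y \<in> ball x0 R"
    have hck: "hausdorff_conv (S \<circ> k) S0" by (rule hausdorff_conv_subseq[OF hc k])
    obtain yy where yy: "\<And>n. yy n \<in> (S \<circ> k) n" "yy \<longlonglongrightarrow> y"
      by (rule hausdorff_conv_approx[OF hck _ _ y(1)]) (use cpt ne in auto)
    have "(\<lambda>n. dist (x (k n)) (yy n)) \<longlonglongrightarrow> dist x0 y" by (intro tendsto_intros lx yy)
    then have "eventually (\<lambda>n. dist (x (k n)) (yy n) < R) sequentially" using y(2) order_tendstoD(2) by (metis mem_ball)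
    then have ev: "eventually (\<lambda>n. yy n = x (k n) + (P (k n) (yy n - x (k n)) + g (k n) (yy n - x (k n)))) sequentially"
    proof eventually_elim
      case (elim n)
      have "yy n \<in> S (k n)" using yy(1)[of n] by simp
      then show ?case using C1a_chart_param[OF ch _ elim] by blast
    qed
    have "(\<lambda>n. x (k n) + (P (k n) (yy n - x (k n)) + g (k n) (yy n - x (k n)))) \<longlonglongrightarrow> x0 + (P' (y - x0) + g' (y - x0))"
      by (intro tendsto_add lx lPz lgz tendsto_diff yy)
    with ev have "yy \<longlonglongrightarrow> x0 + (P' (y - x0) + g' (y - x0))" using tendsto_cong[OF ev] by blast
    then have "y = x0 + (P' (y - x0) + g' (y - x0))" using yy(2) LIMSEQ_unique by blast
    then show "y \<in> (+) x0 ` range (\<lambda>z. P' z + g' z)" by blast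
  next
    fix y assume y: "y \<in> (+) x0 ` range (\<lambda>z. P' z + g' z)" "y \<in> ball x0 R"
    then obtain z where z: "y = x0 + (P' z + g' z)" by blast
    define yy where "yy n = x (k n) + (P (k n) z + g (k n) z)" for n
    have ly: "yy \<longlonglongrightarrow> y" unfolding yy_def z by (intro tendsto_add lx lPz lg tendsto_const)
    have "(\<lambda>n. dist (x (k n)) (yy n)) \<longlonglongrightarrow> dist x0 y" by (intro tendsto_intros lx ly)
    then have "eventually (\<lambda>n. dist (x (k n)) (yy n) < R) sequentially" using y(2) order_tendstoD(2) by (metis mem_ball)
    then have "eventually (\<lambda>n. yy n \<in> (S \<circ> k) n) sequentially"
    proof eventually_elim
      case (elim n)
      then have "yy n \<in> ((+) (x (k n)) ` range (\<lambda>z. P (k n) z + g (k n) z)) \<inter> ball (x (k n)) R"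
        unfolding yy_def by auto
      then show ?case unfolding c(9)[symmetric] by simp
    qed
    then show "y \<in> S0" using hausdorff_conv_limit_mem[OF hausdorff_conv_subseq[OF hc k] \<open>closed S0\<close> _ ly] by blast
  qed auto
  have "C1a_chart \<alpha> L R S0 x0 P' g' A'"
    unfolding C1a_chart_def
  proof (intro conjI allI P' gP' Pg' graph)
    show "g' 0 = 0" using lg[of 0] c(4) by (simp add: LIMSEQ_const_iff)
    show "A' 0 = 0" using lA[of 0] c(5) by (simp add: LIMSEQ_const_iff)
    fix z w
    have "(\<lambda>n. norm (g (k n) z - g (k n) w)) \<longlonglongrightarrow> norm (g' z - g' w)" by (intro tendsto_intros lg)
    then show "norm (g' z - g' w) \<le> norm (z - w)" by (rule LIMSEQ_le_const2) (use c(6) in blast)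
    have "(\<lambda>n. norm (A (k n) z - A (k n) w)) \<longlonglongrightarrow> norm (A' z - A' w)" by (intro tendsto_intros lA)
    then show "norm (A' z - A' w) \<le> L * norm (z - w) powr \<alpha>" by (rule LIMSEQ_le_const2) (use c(7) in blast)
    have "(\<lambda>n. norm (g (k n) w - g (k n) z - A (k n) z (w - z))) \<longlonglongrightarrow> norm (g' w - g' z - A' z (w - z))"
      by (intro tendsto_intros lg lA)
    then show "norm (g' w - g' z - A' z (w - z)) \<le> L * norm (w - z) powr (1 + \<alpha>)"
      by (rule LIMSEQ_le_const2) (use c(8) in blast)
  qed
  moreover have "dim (range (blinfun_apply P')) = m"
  proof -
    obtain n where "dist (P (k n)) P' < 1" using metric_LIMSEQ_D[OF lP, of 1] by auto
    then show ?thesis using oproj_dim_eq[OF c(1) P'] dm by (simp add: dist_norm)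
  qed
  ultimately show ?thesis by blast
qed

section \<open>Change of the base plane of a graph\<close>

text \<open>The triangle inequality gives \<open>norm v \<le> 2 * norm (v + E v)\<close>. Hence the
  map is injective, so invertible in finite dimension, and its inverse is bounded by 2.\<close>

lemma perturbed_identity_inverse:
  fixes E :: "'a::euclidean_space \<Rightarrow>\<^sub>L 'a"
  assumes E: "\<And>v. norm (E v) \<le> norm v / 2"
  obtains V :: "'a \<Rightarrow>\<^sub>L 'a" where "\<And>v. V (v + E v) = v" "\<And>v. norm (V v) \<le> 2 * norm v"
proof -
  define W where "W = id_blinfun + E"
  have W: "W v = v + E v" for v by (simp add: W_def blinfun.add_left)
  have low: "norm v \<le> 2 * norm (W v)" for v
  proof -
    have "norm v \<le> norm (W v) + norm (E v)" unfolding W by norm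
    then show ?thesis using E[of v] by linarith
  qed
  have lin: "linear W" by (intro bounded_linear.linear blinfun.bounded_linear_right)
  have "inj W"
  proof (rule linear_injective_0[THEN iffD2, OF lin], intro allI impI)
    fix v assume "W v = 0"
    then show "v = 0" using low[of v] by simp
  qed
  then obtain f where f: "linear f" "\<And>x. f (W x) = x" "\<And>x. W (f x) = x"
    using linear_injective_isomorphism[OF lin] by blast
  have ap: "Blinfun f v = f v" for v using f(1) by (simp add: bounded_linear_Blinfun_apply linear_conv_bounded_linear)
  show thesis
  proof (rule that[of "Blinfun f"])
    show "Blinfun f (v + E v) = v" for v using f(2)[of v] by (simp add: ap W)
    show "norm (Blinfun f v) \<le> 2 * norm v" for v using low[of "f v"] f(3)[of v] by (simp add: ap)
  qed
qed

text \<open>The inverse \<open>G\<close> of the change of parameters is 2-Lipschitz, and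
  \<open>F \<zeta>\<close> is the component normal to the new plane of the graph point with
  parameter \<open>G \<zeta>\<close>; hence the Lipschitz constant (1 + 1) * 2 = 4. The remainder of
  \<open>F\<close> is computed from that of \<open>g\<close> by linear algebra, with
  \<open>B\<close> as the formal derivative given by the chain rule.\<close>

lemma regraph:
  fixes P Q :: "'a::euclidean_space \<Rightarrow>\<^sub>L 'a" and g :: "'a \<Rightarrow> 'a" and A :: "'a \<Rightarrow> 'a \<Rightarrow>\<^sub>L 'a"
  assumes P: "oproj P" and Q: "oproj Q" and PQ: "norm (P - Q) \<le> 1/6"
    and gQ: "\<And>z. g (Q z) = g z" and Qg: "\<And>z. Q (g z) = 0"
    and lip: "\<And>z w. norm (g z - g w) \<le> norm (z - w)" and Ale: "\<And>z. norm (A z) \<le> 1"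
    and taylor: "\<And>z w. norm (g w - g z - A z (w - z)) \<le> L * norm (w - z) powr (1 + \<alpha>)"
    and "0 < \<alpha>" "\<alpha> \<le> 1" "L \<ge> 0"
  obtains F B where "\<And>\<zeta>. P (F \<zeta>) = 0"
    "(\<lambda>\<zeta>. \<zeta> + F \<zeta>) ` range P = range (\<lambda>z. a + (Q z + g z))"
    "\<And>\<zeta> \<eta>. norm (F \<eta> - F \<zeta>) \<le> 4 * norm (\<eta> - \<zeta>)"
    "\<And>\<zeta> \<eta>. norm (F \<eta> - F \<zeta> - blinfun_apply (B \<zeta>) (\<eta> - \<zeta>)) \<le> 8 * L * norm (\<eta> - \<zeta>) powr (1 + \<alpha>)"
proof -
  note lins = blinfun.add_right blinfun.diff_right blinfun.add_left blinfun.diff_left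
  have PQv: "norm ((P - Q) v) \<le> norm v / 6" for v
    using norm_blinfun[of "P - Q" v] mult_right_mono[OF PQ, of "norm v"] by simp
  \<comment> \<open>\<open>H z = P (a + Q z + g z) + (1 - P) (1 - Q) z\<close> is a Lipschitz perturbation of a translation,
    and it maps \<open>range Q\<close> onto \<open>range P\<close>.\<close>
  define K where "K = (P o\<^sub>L (Q - P)) + ((P - Q) o\<^sub>L Q)"
  have K: "norm (K v) \<le> norm v / 3" for v
  proof -
    have "norm (K v) \<le> norm (P ((Q - P) v)) + norm ((P - Q) (Q v))"
      unfolding K_def by (simp add: blinfun.add_left norm_triangle_ineq)
    moreover have "norm (P ((Q - P) v)) \<le> norm ((P - Q) v)"
      using oproj_norm_le[OF P, of "(Q - P) v"] by (simp add: blinfun.diff_left norm_minus_commute)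
    moreover have "norm (Q v) \<le> norm v" by (rule oproj_norm_le[OF Q])
    ultimately show ?thesis using PQv[of v] PQv[of "Q v"] by linarith
  qed
  define N where "N z = K z + (P - Q) (g z)" for z
  define H where "H z = z + P a + N z" for z
  have H_eq: "H z = P (a + (Q z + g z)) + ((z - Q z) - P (z - Q z))" for z
  proof -
    have "K z = (P (Q z) - P z) + (P (Q z) - Q z)"
      by (simp add: K_def lins oproj_idem[OF P] oproj_idem[OF Q])
    moreover have "(P - Q) (g z) = P (g z)" by (simp add: lins Qg)
    ultimately show ?thesis by (simp add: H_def N_def lins algebra_simps)
  qed
  have Ndiff: "N w - N z = K (w - z) + (P - Q) (g w - g z)" for z w
    by (simp add: N_def lins)
  \<comment> \<open>The linear part contributes 1/3 and the part with \<open>g\<close> contributes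
    1/6. The hypothesis 1/6 on the planes is chosen for this sum.\<close>
  have Nlip: "norm (N w - N z) \<le> norm (w - z) / 2" for z w
    unfolding Ndiff
    using norm_triangle_ineq[of "K (w - z)" "(P - Q) (g w - g z)"] K[of "w - z"] PQv[of "g w - g z"] lip[of w z]
    by linarith
  have "\<exists>z. H z = \<zeta>" for \<zeta>
  proof -
    \<comment> \<open>Solutions of \<open>H z = \<zeta>\<close> are exactly the fixed points of this
      contraction.\<close>
    have "\<exists>!z. \<zeta> - P a - N z = z"
    proof (rule banach_fix_type[of "1/2"], simp, simp, intro allI)
      fix x y show "dist (\<zeta> - P a - N x) (\<zeta> - P a - N y) \<le> 1/2 * dist x y"
        using Nlip[of x y] by (simp add: dist_norm norm_minus_commute)
    qed
    then obtain z where "\<zeta> - P a - N z = z" by blast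
    then have "H z = \<zeta>" by (simp add: H_def algebra_simps)
    then show ?thesis by blast
  qed
  then obtain G where HG: "\<And>\<zeta>. H (G \<zeta>) = \<zeta>" by metis
  have Hlow: "norm (w - z) \<le> 2 * norm (H w - H z)" for w z
  proof -
    have "w - z = (H w - H z) - (N w - N z)" by (simp add: H_def)
    then have "norm (w - z) \<le> norm (H w - H z) + norm (N w - N z)" by (metis norm_triangle_ineq4)
    then show ?thesis using Nlip[of w z] by linarith
  qed
  have GH: "G (H z) = z" for z using Hlow[of "G (H z)" z] HG by simp
  have Glip: "norm (G \<eta> - G \<zeta>) \<le> 2 * norm (\<eta> - \<zeta>)" for \<eta> \<zeta>
    using Hlow[of "G \<eta>" "G \<zeta>"] HG by simp
  have DN: "norm ((K + ((P - Q) o\<^sub>L A z)) v) \<le> norm v / 2" for z v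
  proof -
    have "norm (A z v) \<le> norm v" using norm_blinfun[of "A z" v] mult_right_mono[OF Ale[of z], of "norm v"] by simp
    then show ?thesis using K[of v] PQv[of "A z v"] norm_triangle_ineq[of "K v" "(P - Q) (A z v)"]
      by (simp add: blinfun.add_left)
  qed
  have "\<exists>V :: 'a \<Rightarrow>\<^sub>L 'a. (\<forall>v. V (v + (K + ((P - Q) o\<^sub>L A z)) v) = v) \<and> (\<forall>v. norm (V v) \<le> 2 * norm v)" for z
    using perturbed_identity_inverse[OF DN[of z]] by metis
  then obtain V :: "'a \<Rightarrow> 'a \<Rightarrow>\<^sub>L 'a" where
    V: "\<And>z v. V z (v + (K + ((P - Q) o\<^sub>L A z)) v) = v" "\<And>z v. norm (V z v) \<le> 2 * norm v"
    by metis
  define c where "c z = a + (Q z + g z)" for z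
  define F where "F \<zeta> = c (G \<zeta>) - P (c (G \<zeta>))" for \<zeta>
  define B where "B \<zeta> = (id_blinfun - P) o\<^sub>L (Q + A (G \<zeta>)) o\<^sub>L V (G \<zeta>)" for \<zeta>
  have Fdiff: "F \<eta> - F \<zeta> = (id_blinfun - P) (Q (G \<eta> - G \<zeta>) + (g (G \<eta>) - g (G \<zeta>)))" for \<eta> \<zeta>
    by (simp add: F_def c_def lins)
  have IP: "norm ((id_blinfun - P) v) \<le> norm v" for v
    using oproj_compl_norm_le[OF P] by (simp add: blinfun.diff_left)
  show thesis
  proof (rule that[of F B])
    show "P (F \<zeta>) = 0" for \<zeta> by (simp add: F_def blinfun.diff_right oproj_idem[OF P])
  next
    have on_graph: "\<zeta> + F \<zeta> = c (G \<zeta>) \<and> G \<zeta> = Q (G \<zeta>)" if "\<zeta> \<in> range P" for \<zeta>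
    proof -
      define y where "y = G \<zeta> - Q (G \<zeta>)"
      have \<zeta>: "P (c (G \<zeta>)) + (y - P y) = \<zeta>" using H_eq[of "G \<zeta>"] HG[of \<zeta>] by (simp add: c_def y_def)
      have "P \<zeta> = \<zeta>" using that oproj_range_iff[OF P] by blast
      moreover have "P (P (c (G \<zeta>)) + (y - P y)) = P (c (G \<zeta>))"
        by (simp add: lins oproj_idem[OF P])
      ultimately have "P (c (G \<zeta>)) = \<zeta>" using \<zeta> by simp
      then have "y = P y" using \<zeta> by simp
      moreover have "Q y = 0" by (simp add: y_def lins oproj_idem[OF Q])
      \<comment> \<open>A vector in \<open>range P\<close> and in the kernel of Q equals its own
        image under P - Q, which is too short unless the vector is 0.\<close>
      ultimately have "norm y \<le> norm y / 6" using PQv[of y] by (simp add: blinfun.diff_left)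
      then have "y = 0" by simp
      then show ?thesis using \<open>P (c (G \<zeta>)) = \<zeta>\<close> by (simp add: F_def y_def)
    qed
    have "c z \<in> (\<lambda>\<zeta>. \<zeta> + F \<zeta>) ` range P" for z
    proof -
      have "c z = c (Q z)" by (simp add: c_def gQ oproj_idem[OF Q])
      moreover have "H (Q z) = P (c (Q z))" unfolding H_eq c_def by (simp add: oproj_idem[OF Q] blinfun.zero_right)
      then have "G (P (c (Q z))) = Q z" using GH by metis
      ultimately have "c z = P (c (Q z)) + F (P (c (Q z)))" by (simp add: F_def)
      then show ?thesis by blast
    qed
    then show "(\<lambda>\<zeta>. \<zeta> + F \<zeta>) ` range P = range (\<lambda>z. a + (Q z + g z))"
      unfolding c_def[symmetric] using on_graph by force
  next
    fix \<zeta> \<eta>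
    have "norm (F \<eta> - F \<zeta>) \<le> norm (Q (G \<eta> - G \<zeta>)) + norm (g (G \<eta>) - g (G \<zeta>))"
      unfolding Fdiff using IP norm_triangle_ineq order_trans by blast
    then show "norm (F \<eta> - F \<zeta>) \<le> 4 * norm (\<eta> - \<zeta>)"
      using oproj_norm_le[OF Q, of "G \<eta> - G \<zeta>"] lip[of "G \<eta>" "G \<zeta>"] Glip[of \<eta> \<zeta>] by linarith
  next
    fix \<zeta> \<eta>
    \<comment> \<open>Here u is the displacement of the old parameters and r the remainder of
      \<open>g\<close>. The linear model recovers u from \<eta> - \<zeta> up to the correction s,
      which is r passed through P - Q and \<open>V z\<close>.\<close>
    define z u where "z = G \<zeta>" and "u = G \<eta> - G \<zeta>"
    define r where "r = g (G \<eta>) - g (G \<zeta>) - A z u"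
    define s where "s = V z ((P - Q) r)"
    have g_eq: "g (G \<eta>) - g (G \<zeta>) = A z u + r" by (simp add: r_def)
    have "\<eta> - \<zeta> = H (G \<eta>) - H (G \<zeta>)" by (simp add: HG)
    also have "\<dots> = u + (N (G \<eta>) - N (G \<zeta>))" by (simp add: H_def u_def)
    also have "\<dots> = u + (K u + (P - Q) (A z u + r))" by (simp only: Ndiff g_eq u_def[symmetric])
    also have "\<dots> = (u + (K + ((P - Q) o\<^sub>L A z)) u) + (P - Q) r"
      by (simp add: lins)
    finally have "V z (\<eta> - \<zeta>) = V z (u + (K + ((P - Q) o\<^sub>L A z)) u) + s"
      by (simp only: blinfun.add_right s_def)
    then have "V z (\<eta> - \<zeta>) = u + s" unfolding V(1) .
    then have "B \<zeta> (\<eta> - \<zeta>) = (id_blinfun - P) ((Q + A z) (u + s))" by (simp add: B_def z_def)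
    then have "F \<eta> - F \<zeta> - B \<zeta> (\<eta> - \<zeta>) = (id_blinfun - P) (Q u + (A z u + r) - (Q + A z) (u + s))"
      unfolding Fdiff g_eq u_def[symmetric] by (simp only: blinfun.diff_right)
    also have "Q u + (A z u + r) - (Q + A z) (u + s) = r - (Q s + A z s)" by (simp add: lins)
    finally have eq: "F \<eta> - F \<zeta> - B \<zeta> (\<eta> - \<zeta>) = (id_blinfun - P) (r - (Q s + A z s))" .
    have "norm (F \<eta> - F \<zeta> - B \<zeta> (\<eta> - \<zeta>)) \<le> norm (r - (Q s + A z s))" unfolding eq by (rule IP)
    also have "\<dots> \<le> norm r + (norm (Q s) + norm (A z s))" by norm
    also have "\<dots> \<le> norm r + (norm s + norm s)"
      using oproj_norm_le[OF Q, of s] norm_blinfun[of "A z" s] mult_right_mono[OF Ale[of z], of "norm s"] by simp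
    finally have Fs: "norm (F \<eta> - F \<zeta> - B \<zeta> (\<eta> - \<zeta>)) \<le> norm r + (norm s + norm s)" .
    \<comment> \<open>The bound 2 for \<open>V z\<close> times 1/6 for P - Q. The total error (1 +
      2/3) \<open>norm r\<close> is rounded up to 2 \<open>norm r\<close>; the other factor 4 of the
      constant 8 L bounds \<open>2 powr (1 + \<alpha>)\<close>, the cost of the Lipschitz constant
      of \<open>G\<close>.\<close>
    have "norm s \<le> norm r / 3" using V(2)[of z "(P - Q) r"] PQv[of r] by (simp add: s_def)
    with Fs have Fr: "norm (F \<eta> - F \<zeta> - B \<zeta> (\<eta> - \<zeta>)) \<le> 2 * norm r" using norm_ge_zero[of r] by linarith
    have rL: "norm r \<le> L * norm u powr (1 + \<alpha>)" using taylor[of "G \<eta>" "G \<zeta>"] by (simp add: r_def z_def u_def)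
    have "norm u powr (1 + \<alpha>) \<le> (2 * norm (\<eta> - \<zeta>)) powr (1 + \<alpha>)"
      using Glip[of \<eta> \<zeta>] \<open>0 < \<alpha>\<close> by (intro powr_mono2) (auto simp: u_def)
    also have "\<dots> = 2 powr (1 + \<alpha>) * norm (\<eta> - \<zeta>) powr (1 + \<alpha>)" by (simp add: powr_mult)
    also have "\<dots> \<le> 2 powr 2 * norm (\<eta> - \<zeta>) powr (1 + \<alpha>)"
      using \<open>\<alpha> \<le> 1\<close> by (intro mult_right_mono powr_mono) auto
    finally have "L * norm u powr (1 + \<alpha>) \<le> L * (4 * norm (\<eta> - \<zeta>) powr (1 + \<alpha>))"
      using \<open>L \<ge> 0\<close> by (intro mult_left_mono) auto
    then show "norm (F \<eta> - F \<zeta> - B \<zeta> (\<eta> - \<zeta>)) \<le> 8 * L * norm (\<eta> - \<zeta>) powr (1 + \<alpha>)"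
      using Fr rL by linarith
  qed
qed

section \<open>Remainder estimates and cutoffs\<close>

text \<open>A C^{1,\<alpha>} bound expressed without comparing derivatives at two points. Increments
  stop at length 1 because the quadratic errors of a cutoff are dominated by the power 1 + \<alpha>
  only up to there.\<close>

definition taylor_on :: "'a::real_normed_vector set \<Rightarrow> real \<Rightarrow> real \<Rightarrow> ('a \<Rightarrow> 'b::real_normed_vector) \<Rightarrow> ('a \<Rightarrow> 'a \<Rightarrow> 'b) \<Rightarrow> bool" where
  "taylor_on T \<alpha> C G D \<longleftrightarrow> (\<forall>z\<in>T. bounded_linear (D z)) \<and>
     (\<forall>z\<in>T. \<forall>w\<in>T. norm (w - z) \<le> 1 \<longrightarrow> norm (G w - G z - D z (w - z)) \<le> C * norm (w - z) powr (1 + \<alpha>))"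

lemma taylor_onD:
  assumes "taylor_on T \<alpha> C G D" "z \<in> T"
  shows taylor_on_linear: "bounded_linear (D z)"
    and taylor_on_le: "w \<in> T \<Longrightarrow> norm (w - z) \<le> 1 \<Longrightarrow> norm (G w - G z - D z (w - z)) \<le> C * norm (w - z) powr (1 + \<alpha>)"
  using assms by (auto simp: taylor_on_def)

text \<open>Interpolation: an increment of length t along v isolates the derivative, the size of G
  contributing \<open>2 * M / t\<close> and the remainder \<open>C * t powr \<alpha>\<close>. The
  length t stays free so that the two can be balanced.\<close>

lemma taylor_on_deriv_le:
  assumes T: "subspace T" and G: "taylor_on T \<alpha> C G D" and M: "\<And>z. z \<in> T \<Longrightarrow> norm (G z) \<le> M"
    and z: "z \<in> T" and v: "v \<in> T" and t: "0 < t" "t \<le> 1"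
  shows "norm (D z v) \<le> (2 * M / t + C * t powr \<alpha>) * norm v"
proof (cases "v = 0")
  case True
  then show ?thesis using taylor_on_linear[OF G z] by (simp add: linear_simps)
next
  case False
  define u where "u = (t / norm v) *\<^sub>R v"
  have nu: "norm u = t" using False t by (simp add: u_def)
  have zu: "z + u \<in> T" unfolding u_def using T z v by (intro subspace_add subspace_scale)
  have "norm (D z u) \<le> norm (G (z + u)) + norm (G z) + norm (G (z + u) - G z - D z u)" by norm
  also have "\<dots> \<le> M + M + C * t powr (1 + \<alpha>)"
    using taylor_on_le[OF G z zu] M[OF z] M[OF zu] nu t by simp
  also have "\<dots> = t * (2 * M / t + C * t powr \<alpha>)" using t by (simp add: powr_add field_simps)
  finally have "norm (D z u) \<le> t * (2 * M / t + C * t powr \<alpha>)" .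
  moreover have "norm (D z u) = t * (norm (D z v) / norm v)"
    using taylor_on_linear[OF G z] t by (simp add: u_def linear_simps)
  ultimately have "norm (D z v) / norm v \<le> 2 * M / t + C * t powr \<alpha>" using t(1) by (metis mult_le_cancel_left_pos)
  then show ?thesis using False pos_divide_le_eq[of "norm v"] by simp
qed

text \<open>Expand at z and at w, and evaluate at a common point w + u with u parallel to v and as
  long as z - w. The three remainders contribute 1 + 1 + 4, where 4 bounds
  \<open>2 powr (1 + \<alpha>)\<close>. The restriction to 1/2 keeps w + u within distance 1 of
  z.\<close>

lemma taylor_on_holder:
  assumes T: "subspace T" and G: "taylor_on T \<alpha> C G D" and "0 < \<alpha>" "\<alpha> \<le> 1" "C \<ge> 0"
    and z: "z \<in> T" and w: "w \<in> T" and v: "v \<in> T" and h: "norm (z - w) \<le> 1/2"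
  shows "norm (D z v - D w v) \<le> 6 * C * norm (z - w) powr \<alpha> * norm v"
proof (cases "v = 0 \<or> z = w")
  case True
  then show ?thesis using taylor_on_linear[OF G z] taylor_on_linear[OF G w] by (auto simp: linear_simps)
next
  case False
  define t where "t = norm (w - z)"
  have t: "0 < t" "t \<le> 1/2" using False h by (auto simp: t_def norm_minus_commute)
  define u where "u = (t / norm v) *\<^sub>R v"
  have nu: "norm u = t" using False t by (simp add: u_def)
  have wu: "w + u \<in> T" unfolding u_def using T w v by (intro subspace_add subspace_scale)
  have n2: "norm (w + u - z) \<le> 2 * t" using norm_triangle_ineq[of "w - z" u] nu by (simp add: t_def algebra_simps)
  have 1: "norm (G (w + u) - G w - D w u) \<le> C * t powr (1 + \<alpha>)"
    using taylor_on_le[OF G w wu] nu t by simp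
  have 2: "norm (G w - G z - D z (w - z)) \<le> C * t powr (1 + \<alpha>)"
    using taylor_on_le[OF G z w] t by (simp add: t_def)
  have "norm (G (w + u) - G z - D z (w + u - z)) \<le> C * norm (w + u - z) powr (1 + \<alpha>)"
    using taylor_on_le[OF G z wu] n2 t by simp
  also have "\<dots> \<le> C * (2 * t) powr (1 + \<alpha>)"
    using n2 \<open>0 < \<alpha>\<close> \<open>C \<ge> 0\<close> by (intro mult_left_mono powr_mono2) auto
  also have "\<dots> \<le> C * (2 powr 2 * t powr (1 + \<alpha>))"
    unfolding powr_mult using \<open>\<alpha> \<le> 1\<close> \<open>C \<ge> 0\<close> by (intro mult_left_mono mult_right_mono powr_mono) auto
  finally have 3: "norm (G (w + u) - G z - D z (w + u - z)) \<le> 4 * (C * t powr (1 + \<alpha>))" by simp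
  have "D z (w + u - z) = D z (w - z) + D z u"
    using linear_add[OF bounded_linear.linear[OF taylor_on_linear[OF G z]], of "w - z" u] by (simp add: algebra_simps)
  then have "D z u - D w u = (G (w + u) - G w - D w u) + (G w - G z - D z (w - z)) - (G (w + u) - G z - D z (w + u - z))"
    by simp
  then have "norm (D z u - D w u) \<le> norm (G (w + u) - G w - D w u) + norm (G w - G z - D z (w - z))
      + norm (G (w + u) - G z - D z (w + u - z))"
    by (metis norm_triangle_ineq norm_triangle_ineq4 order_trans add_right_mono)
  also have "\<dots> \<le> 6 * (C * t powr (1 + \<alpha>))" using 1 2 3 by linarith
  also have "\<dots> = t * (6 * C * t powr \<alpha>)" using t by (simp add: powr_add)
  finally have "norm (D z u - D w u) \<le> t * (6 * C * t powr \<alpha>)" .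
  moreover have "D z u - D w u = (t / norm v) *\<^sub>R (D z v - D w v)"
    using taylor_on_linear[OF G z] taylor_on_linear[OF G w] by (simp add: u_def linear_simps scaleR_diff_right)
  then have "norm (D z u - D w u) = t * (norm (D z v - D w v) / norm v)" using t by simp
  ultimately have "norm (D z v - D w v) / norm v \<le> 6 * C * t powr \<alpha>" using t(1) by (metis mult_le_cancel_left_pos)
  then show ?thesis using False pos_divide_le_eq[of "norm v"] by (simp add: t_def norm_minus_commute)
qed

lemma small_powr:
  fixes \<gamma> e C :: real
  assumes "\<gamma> > 0" "e > 0" "C \<ge> 0"
  obtains t where "0 < t" "t \<le> 1/2" "C * t powr \<gamma> \<le> e"
proof -
  define t where "t = min (1/2) ((e / (C + 1)) powr (1/\<gamma>))"
  have q: "e / (C + 1) > 0" using assms by simp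
  have t: "0 < t" "t \<le> 1/2" using q by (auto simp: t_def)
  have "t powr \<gamma> \<le> ((e / (C + 1)) powr (1/\<gamma>)) powr \<gamma>"
    using t assms by (intro powr_mono2) (auto simp: t_def)
  also have "\<dots> = e / (C + 1)" using q assms by (simp add: powr_powr)
  finally have "C * t powr \<gamma> \<le> C * (e / (C + 1))" using assms by (intro mult_left_mono) auto
  also have "\<dots> \<le> e" using assms by (simp add: field_simps)
  finally show thesis using that t by blast
qed

text \<open>Two scales: up to distance \<tau> the Hoelder bound with exponent \<alpha> has the spare
  factor \<open>\<tau> powr (\<alpha> - \<beta>)\<close>; beyond \<tau> the derivatives themselves
  are small, and dividing by the power \<beta> of the distance costs only a fixed factor.\<close>

lemma C1a_norm_tendsto_zero_of_taylor:
  fixes T :: "'a::euclidean_space set"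
  assumes T: "subspace T" and ab: "0 < \<beta>" "\<beta> < \<alpha>" "\<alpha> \<le> 1" and C: "C \<ge> 0"
    and G: "\<And>j. j \<ge> j0 \<Longrightarrow> taylor_on T \<alpha> C (G j) (D j)"
    and sup: "\<And>e. e > 0 \<Longrightarrow> eventually (\<lambda>j. \<forall>z\<in>T. norm (G j z) \<le> e) sequentially"
  shows "C1a_norm_tendsto_zero T \<beta> G D"
  unfolding C1a_norm_tendsto_zero_def
proof (intro allI impI)
  fix e :: real assume e: "e > 0"
  obtain \<tau> where \<tau>: "0 < \<tau>" "\<tau> \<le> 1/2" "6 * C * \<tau> powr (\<alpha> - \<beta>) \<le> e"
    using small_powr[of "\<alpha> - \<beta>" e "6 * C"] ab e C by auto
  \<comment> \<open>The target bound for the derivatives. One half of it goes to the remainder at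
    length t, the other to the sup norm s through \<open>2 * s / t\<close>.\<close>
  define a where "a = min e (e * \<tau> powr \<beta> / 2)"
  have a: "a > 0" "a \<le> e" "2 * a \<le> e * \<tau> powr \<beta>" using e \<tau> by (auto simp: a_def)
  obtain t where t: "0 < t" "t \<le> 1/2" "C * t powr \<alpha> \<le> a / 2"
    using small_powr[of \<alpha> "a/2" C] ab a C by auto
  define s where "s = min e (a * t / 4)"
  have s: "s > 0" "s \<le> e" "2 * s / t \<le> a / 2" using e a t by (auto simp: s_def field_simps)
  from sup[OF s(1)] eventually_ge_at_top[of j0]
  show "eventually (\<lambda>j.
        (\<forall>\<xi>\<in>T. norm (G j \<xi>) \<le> e) \<and>
        (\<forall>\<xi>\<in>T. \<forall>v\<in>T. norm (D j \<xi> v) \<le> e * norm v) \<and>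
        (\<forall>\<xi>\<in>T. \<forall>\<eta>\<in>T. \<forall>v\<in>T. norm (D j \<xi> v - D j \<eta> v) \<le> e * norm (\<xi> - \<eta>) powr \<beta> * norm v)) sequentially"
  proof eventually_elim
    case (elim j)
    have Gs: "norm (G j z) \<le> s" if "z \<in> T" for z using elim that by blast
    have Da: "norm (D j \<xi> v) \<le> a * norm v" if "\<xi> \<in> T" "v \<in> T" for \<xi> v
    proof -
      have "norm (D j \<xi> v) \<le> (2 * s / t + C * t powr \<alpha>) * norm v"
        using taylor_on_deriv_le[OF T G[OF elim(2)] Gs that t(1)] t(2) by simp
      also have "\<dots> \<le> a * norm v" using s t by (intro mult_right_mono) auto
      finally show ?thesis .
    qed
    have "norm (D j \<xi> v - D j \<eta> v) \<le> e * norm (\<xi> - \<eta>) powr \<beta> * norm v"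
      if m: "\<xi> \<in> T" "\<eta> \<in> T" "v \<in> T" for \<xi> \<eta> v
    proof (cases "norm (\<xi> - \<eta>) \<le> \<tau>")
      case True
      have "norm (D j \<xi> v - D j \<eta> v) \<le> 6 * C * norm (\<xi> - \<eta>) powr \<alpha> * norm v"
        using taylor_on_holder[OF T G[OF elim(2)] _ ab(3) C m] ab True \<tau> by simp
      also have "\<dots> = 6 * C * norm (\<xi> - \<eta>) powr (\<alpha> - \<beta>) * norm (\<xi> - \<eta>) powr \<beta> * norm v"
        by (simp add: powr_add[symmetric])
      also have "6 * C * norm (\<xi> - \<eta>) powr (\<alpha> - \<beta>) \<le> 6 * C * \<tau> powr (\<alpha> - \<beta>)"
        using True ab C by (intro mult_left_mono powr_mono2) auto
      also have "\<dots> \<le> e" by (rule \<tau>)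
      finally show ?thesis by (simp add: mult_right_mono)
    next
      case False
      have "norm (D j \<xi> v - D j \<eta> v) \<le> 2 * a * norm v"
        using norm_triangle_ineq4[of "D j \<xi> v" "D j \<eta> v"] Da[OF m(1,3)] Da[OF m(2,3)] by linarith
      also have "\<dots> \<le> e * \<tau> powr \<beta> * norm v" using a by (intro mult_right_mono) auto
      also have "\<dots> \<le> e * norm (\<xi> - \<eta>) powr \<beta> * norm v"
        using False e ab \<tau> by (intro mult_right_mono mult_left_mono powr_mono2) auto
      finally show ?thesis .
    qed
    moreover have "norm (D j \<xi> v) \<le> e * norm v" if "\<xi> \<in> T" "v \<in> T" for \<xi> v
      using Da[OF that] mult_right_mono[OF a(2), of "norm v"] by simp
    ultimately show ?case using Gs s(2) by force
  qed
qed

text \<open>At distances above 1/2 the derivatives of G are bounded by 2 M + C, which is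
  interpolation with t = 1; as the power \<alpha> of the distance is then at least 1/2, a Hoelder
  bound with constant 4 (2 M + C) results.\<close>

lemma C1a_on_add_taylor:
  fixes T :: "'a::euclidean_space set"
  assumes T: "subspace T" and \<alpha>: "0 < \<alpha>" "\<alpha> \<le> 1" and C: "C \<ge> 0"
    and f: "C1a_on T \<alpha> f Df" and G: "taylor_on T \<alpha> C G D"
    and M: "\<And>z. z \<in> T \<Longrightarrow> norm (G z) \<le> M" and perp: "\<And>z. z \<in> T \<Longrightarrow> G z \<in> orthogonal_comp T"
  shows "C1a_on T \<alpha> (\<lambda>z. f z + G z) (\<lambda>z v. Df z v + D z v)"
  unfolding C1a_on_def
proof (intro conjI ballI allI impI)
  fix \<xi> assume \<xi>: "\<xi> \<in> T"
  show "f \<xi> + G \<xi> \<in> orthogonal_comp T"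
    using f \<xi> by (intro subspace_add[OF subspace_orthogonal_comp] perp) (simp_all add: C1a_on_def)
  have "(G has_derivative D \<xi>) (at \<xi> within T)"
    by (rule has_derivative_of_taylor[OF \<alpha>(1) taylor_on_linear[OF G \<xi>] taylor_on_le[OF G \<xi>]])
  then show "((\<lambda>z. f z + G z) has_derivative (\<lambda>v. Df \<xi> v + D \<xi> v)) (at \<xi> within T)"
    using f \<xi> by (intro has_derivative_add) (auto simp: C1a_on_def)
next
  fix r :: real assume "r > 0"
  then obtain C1 where C1: "\<And>\<xi> \<eta> v. \<xi> \<in> T \<Longrightarrow> \<eta> \<in> T \<Longrightarrow> norm \<xi> \<le> r \<Longrightarrow> norm \<eta> \<le> r \<Longrightarrow> v \<in> T \<Longrightarrow>
      norm (Df \<xi> v - Df \<eta> v) \<le> C1 * norm (\<xi> - \<eta>) powr \<alpha> * norm v"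
    using f unfolding C1a_on_def by blast
  have M0: "M \<ge> 0" using M[OF subspace_0[OF T]] norm_ge_zero order_trans by blast
  define b where "b = 2 * M + C"
  have b: "b \<ge> 0" using M0 C by (simp add: b_def)
  define C2 where "C2 = 6 * C + 4 * b"
  have D2: "norm (D \<xi> v - D \<eta> v) \<le> C2 * norm (\<xi> - \<eta>) powr \<alpha> * norm v" if m: "\<xi> \<in> T" "\<eta> \<in> T" "v \<in> T" for \<xi> \<eta> v
  proof (cases "norm (\<xi> - \<eta>) \<le> 1/2")
    case True
    have "norm (D \<xi> v - D \<eta> v) \<le> 6 * C * norm (\<xi> - \<eta>) powr \<alpha> * norm v"
      by (rule taylor_on_holder[OF T G \<alpha> C m True])
    also have "\<dots> \<le> C2 * norm (\<xi> - \<eta>) powr \<alpha> * norm v"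
      using b by (intro mult_right_mono) (auto simp: C2_def)
    finally show ?thesis .
  next
    case False
    have "(1/2) powr 1 \<le> (1/2::real) powr \<alpha>" using \<alpha> by (intro powr_mono') auto
    also have "\<dots> \<le> norm (\<xi> - \<eta>) powr \<alpha>" using False \<alpha> by (intro powr_mono2) auto
    finally have h: "1 \<le> 2 * norm (\<xi> - \<eta>) powr \<alpha>" by simp
    have "norm (D \<xi> v - D \<eta> v) \<le> (2 * b) * 1 * norm v"
    proof -
      have "norm (D \<xi> v) \<le> b * norm v" "norm (D \<eta> v) \<le> b * norm v"
        using taylor_on_deriv_le[OF T G M m(1,3), of 1] taylor_on_deriv_le[OF T G M m(2,3), of 1]
        by (simp_all add: b_def)
      then show ?thesis using norm_triangle_ineq4[of "D \<xi> v" "D \<eta> v"] by linarith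
    qed
    also have "\<dots> \<le> (2 * b) * (2 * norm (\<xi> - \<eta>) powr \<alpha>) * norm v"
      using h b by (intro mult_right_mono mult_left_mono) auto
    also have "\<dots> = (4 * b) * norm (\<xi> - \<eta>) powr \<alpha> * norm v" by simp
    also have "\<dots> \<le> C2 * norm (\<xi> - \<eta>) powr \<alpha> * norm v"
      using C by (intro mult_right_mono) (auto simp: C2_def)
    finally show ?thesis .
  qed
  have "norm (Df \<xi> v + D \<xi> v - (Df \<eta> v + D \<eta> v)) \<le> (C1 + C2) * norm (\<xi> - \<eta>) powr \<alpha> * norm v"
    if m: "\<xi> \<in> T" "\<eta> \<in> T" "norm \<xi> \<le> r" "norm \<eta> \<le> r" "v \<in> T" for \<xi> \<eta> v
  proof -
    have "norm (Df \<xi> v + D \<xi> v - (Df \<eta> v + D \<eta> v)) \<le> norm (Df \<xi> v - Df \<eta> v) + norm (D \<xi> v - D \<eta> v)"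
      by norm
    then show ?thesis using C1[OF m] D2[OF m(1,2,5)] by (simp add: algebra_simps)
  qed
  then show "\<exists>C. \<forall>\<xi>\<in>T. \<forall>\<eta>\<in>T. norm \<xi> \<le> r \<longrightarrow> norm \<eta> \<le> r \<longrightarrow>
        (\<forall>v\<in>T. norm (Df \<xi> v + D \<xi> v - (Df \<eta> v + D \<eta> v)) \<le> C * norm (\<xi> - \<eta>) powr \<alpha> * norm v)" by blast
qed

section \<open>Cutoff functions of class C^{1,1}\<close>

text \<open>\<open>k\<close> is the squared distance to the ball of radius r, \<open>z - q z\<close>
  is the point of the ball nearest to z, and twice \<open>q\<close> is the gradient of
  \<open>k\<close>. The upper estimate bounds the distance of w by its distance to the point nearest
  to z; the lower one is convexity of \<open>k\<close>.\<close>

lemma sq_dist_ball_taylor: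
  fixes w z :: "'a::real_inner"
  assumes "r > 0"
  defines "k \<equiv> \<lambda>z::'a. (max 0 (norm z - r))\<^sup>2" and "q \<equiv> \<lambda>z::'a. max 0 (1 - r / norm z) *\<^sub>R z"
  shows "\<bar>k w - k z - 2 * (q z \<bullet> (w - z))\<bar> \<le> (norm (w - z))\<^sup>2"
proof -
  have nq: "norm (q z) = max 0 (norm z - r)" for z
    using \<open>r > 0\<close> by (cases "z = 0") (auto simp: q_def max_def field_simps)
  have up: "k w - k z - 2 * (q z \<bullet> (w - z)) \<le> (norm (w - z))\<^sup>2"
  proof -
    have "norm (z - q z) \<le> r"
    proof (cases "norm z \<le> r")
      case True
      then have "q z = 0" using \<open>r > 0\<close> by (cases "z = 0") (auto simp: q_def max_def field_simps)
      then show ?thesis using True by simp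
    next
      case False
      then have "norm z > 0" using \<open>r > 0\<close> by linarith
      then have "max 0 (1 - r / norm z) = 1 - r / norm z" using False by (simp add: max_def)
      then have "z - q z = (r / norm z) *\<^sub>R z" by (simp add: q_def scaleR_diff_left)
      then show ?thesis using \<open>r > 0\<close> \<open>norm z > 0\<close> by simp
    qed
    moreover have "norm w \<le> norm ((w - z) + q z) + norm (z - q z)" by norm
    ultimately have "max 0 (norm w - r) \<le> norm ((w - z) + q z)" by auto
    then have "k w \<le> (norm ((w - z) + q z))\<^sup>2" unfolding k_def by (intro power_mono) auto
    also have "\<dots> = (norm (w - z))\<^sup>2 + 2 * (q z \<bullet> (w - z)) + (norm (q z))\<^sup>2"
      by (simp add: power2_norm_eq_inner inner_add_left inner_add_right inner_commute)
    finally show ?thesis by (simp add: nq k_def)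
  qed
  have low: "k w - k z - 2 * (q z \<bullet> (w - z)) \<ge> 0"
  proof (cases "norm z \<le> r")
    case True
    then have "norm (q z) = 0" by (simp add: nq)
    then show ?thesis using True by (simp add: k_def)
  next
    case False
    define a b where "a = norm z - r" and "b = norm w - r"
    have a: "a > 0" using False by (simp add: a_def)
    have nz: "norm z > 0" using False \<open>r > 0\<close> by linarith
    have q: "q z = (a / norm z) *\<^sub>R z"
      using False nz by (auto simp: q_def a_def max_def field_simps)
    have "z \<bullet> w \<le> norm z * norm w" by (rule norm_cauchy_schwarz)
    then have "a / norm z * (z \<bullet> w) \<le> a / norm z * (norm z * norm w)" using a nz by (intro mult_left_mono) auto
    then have "q z \<bullet> w \<le> a * norm w" using nz by (simp add: q)
    moreover have "q z \<bullet> z = a * norm z" using nz by (simp add: q power2_norm_eq_inner[symmetric] power2_eq_square)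
    ultimately have "q z \<bullet> (w - z) \<le> a * (b - a)" by (simp add: inner_diff_right a_def b_def algebra_simps)
    \<comment> \<open>What remains is the tangent line inequality for the convex function
      \<open>(max 0 b)\<^sup>2\<close> of b at the point a > 0.\<close>
    moreover have "(max 0 b)\<^sup>2 - a\<^sup>2 \<ge> 2 * (a * (b - a))"
    proof (cases "b \<ge> 0")
      case True
      then show ?thesis using zero_le_power2[of "b - a"] by (simp add: power2_eq_square algebra_simps)
    next
      case False
      then have "a * b \<le> 0" using a by (simp add: mult_nonneg_nonpos)
      moreover have "a * a \<ge> 0" by simp
      moreover have "2 * (a * (b - a)) = 2 * (a * b) - 2 * (a * a)" by (simp add: algebra_simps)
      moreover have "(max 0 b)\<^sup>2 - a\<^sup>2 = - (a * a)" using False by (simp add: power2_eq_square)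
      ultimately show ?thesis by linarith
    qed
    ultimately show ?thesis using a by (simp add: k_def a_def b_def)
  qed
  show ?thesis using up low by simp
qed

text \<open>As \<alpha> \<le> 1, squares of increments of length at most 1 are dominated by their
  powers 1 + \<alpha>, so a cutoff with quadratic remainder is regular enough.\<close>

lemma cutoff_exists:
  fixes \<rho> :: real
  assumes "\<rho> > 0"
  obtains \<psi> :: "'a::real_inner \<Rightarrow> real" and D :: "'a \<Rightarrow> 'a" and K :: real where
    "K \<ge> 0" "\<And>z. norm z \<le> \<rho> \<Longrightarrow> \<psi> z = 1" "\<And>z. norm z \<ge> 2 * \<rho> \<Longrightarrow> \<psi> z = 0 \<and> D z = 0"
    "\<And>z. \<bar>\<psi> z\<bar> \<le> K" "\<And>z w. norm (w - z) \<le> 1 \<Longrightarrow> \<bar>\<psi> w - \<psi> z\<bar> \<le> K * norm (w - z)"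
    "\<And>z w. \<bar>\<psi> w - \<psi> z - D z \<bullet> (w - z)\<bar> \<le> K * (norm (w - z))\<^sup>2"
proof -
  define k where "k r z = (max 0 (norm z - r))\<^sup>2" for r and z :: 'a
  define q where "q r z = max 0 (1 - r / norm z) *\<^sub>R z" for r and z :: 'a
  have kt: "\<bar>k r w - k r z - 2 * (q r z \<bullet> (w - z))\<bar> \<le> (norm (w - z))\<^sup>2" if "r > 0" for r w z
    unfolding k_def q_def by (rule sq_dist_ball_taylor[OF that])
  have nq: "norm (q r z) = max 0 (norm z - r)" if "r > 0" for r z
    using that by (cases "z = 0") (auto simp: q_def max_def field_simps)
  \<comment> \<open>Second difference in \<open>r\<close> of \<open>dist(z, B\<^sub>r)\<^sup>2\<close>: it vanishes for \<open>norm z \<le> \<rho>\<close> and is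
    constant for \<open>norm z \<ge> 2 * \<rho>\<close>.\<close>
  define \<psi> where "\<psi> z = 1 - 2 / \<rho>\<^sup>2 * (k \<rho> z - 2 * k (3/2 * \<rho>) z + k (2 * \<rho>) z)" for z
  define D where "D z = (- 4 / \<rho>\<^sup>2) *\<^sub>R (q \<rho> z - 2 *\<^sub>R q (3/2 * \<rho>) z + q (2 * \<rho>) z)" for z
  \<comment> \<open>One constant for the bound 4 on \<open>\<psi>\<close>, the gradient bound 8 /
    \<rho> and the remainder \<open>8 / \<rho>\<^sup>2\<close>; the last two together give the
    Lipschitz constant for increments of length at most 1.\<close>
  define K where "K = 4 + 8 / \<rho> + 8 / \<rho>\<^sup>2"
  have K: "K \<ge> 0" using assms by (simp add: K_def)
  have inner1: "\<psi> z = 1" if "norm z \<le> \<rho>" for z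
    using that assms by (simp add: \<psi>_def k_def max_def)
  have outer: "\<psi> z = 0 \<and> D z = 0" if "norm z \<ge> 2 * \<rho>" for z
  proof
    \<comment> \<open>This constant value dictates the normalization
      \<open>2 / \<rho>\<^sup>2\<close> in \<open>\<psi>\<close>.\<close>
    have "k \<rho> z - 2 * k (3/2 * \<rho>) z + k (2 * \<rho>) z = \<rho>\<^sup>2 / 2"
      using that assms by (simp add: k_def max_def power2_eq_square algebra_simps)
    then show "\<psi> z = 0" using assms by (simp add: \<psi>_def)
    have nz: "norm z > 0" using that assms by linarith
    have q: "q r z = (1 - r / norm z) *\<^sub>R z" if "r \<le> 2 * \<rho>" for r
      using that \<open>norm z \<ge> 2 * \<rho>\<close> nz by (simp add: q_def max_def field_simps)
    have "q \<rho> z - 2 *\<^sub>R q (3/2 * \<rho>) z + q (2 * \<rho>) z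
        = ((1 - \<rho> / norm z) - 2 * (1 - 3/2 * \<rho> / norm z) + (1 - 2 * \<rho> / norm z)) *\<^sub>R z"
    proof -
      have "2 *\<^sub>R q (3/2 * \<rho>) z = (2 * (1 - 3/2 * \<rho> / norm z)) *\<^sub>R z"
        using assms by (subst q) simp_all
      moreover have "q \<rho> z = (1 - \<rho> / norm z) *\<^sub>R z" "q (2 * \<rho>) z = (1 - 2 * \<rho> / norm z) *\<^sub>R z"
        using assms by (auto intro: q)
      ultimately show ?thesis by (simp only: scaleR_diff_left scaleR_add_left)
    qed
    also have "\<dots> = 0" by simp
    finally show "D z = 0" by (simp add: D_def)
  qed
  have bound: "\<bar>\<psi> z\<bar> \<le> 4 \<and> norm (D z) \<le> 8 / \<rho>" for z
  proof (cases "norm z \<ge> 2 * \<rho>")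
    case True
    then show ?thesis using outer[OF True] assms by simp
  next
    case False
    have 1: "0 \<le> k \<rho> z" "k \<rho> z \<le> \<rho>\<^sup>2" using False assms by (auto simp: k_def intro!: power_mono)
    have "k (3/2 * \<rho>) z \<le> (\<rho>/2)\<^sup>2" unfolding k_def using False assms by (intro power_mono) (auto simp: max_def)
    then have 2: "0 \<le> k (3/2 * \<rho>) z" "2 * k (3/2 * \<rho>) z \<le> \<rho>\<^sup>2 / 2"
      by (auto simp: k_def power_divide)
    have 3: "k (2 * \<rho>) z = 0" using False by (simp add: k_def)
    have "2 / \<rho>\<^sup>2 * \<bar>k \<rho> z - 2 * k (3/2 * \<rho>) z\<bar> \<le> 2 / \<rho>\<^sup>2 * \<rho>\<^sup>2"
      using 1 2 by (intro mult_left_mono) auto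
    then have "2 / \<rho>\<^sup>2 * \<bar>k \<rho> z - 2 * k (3/2 * \<rho>) z\<bar> \<le> 2" using assms by simp
    moreover have "\<bar>2 / \<rho>\<^sup>2 * (k \<rho> z - 2 * k (3/2 * \<rho>) z)\<bar> = 2 / \<rho>\<^sup>2 * \<bar>k \<rho> z - 2 * k (3/2 * \<rho>) z\<bar>"
      unfolding abs_mult by simp
    moreover have "\<psi> z = 1 - 2 / \<rho>\<^sup>2 * (k \<rho> z - 2 * k (3/2 * \<rho>) z)" by (simp only: \<psi>_def 3 add_0_right)
    ultimately have c: "\<bar>\<psi> z\<bar> \<le> 4" by linarith
    have "norm (q \<rho> z - 2 *\<^sub>R q (3/2 * \<rho>) z + q (2 * \<rho>) z)
        \<le> norm (q \<rho> z) + 2 * norm (q (3/2 * \<rho>) z) + norm (q (2 * \<rho>) z)" by norm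
    also have "\<dots> \<le> \<rho> + 2 * (\<rho> / 2) + 0" using False assms by (intro add_mono mult_left_mono) (auto simp: nq max_def)
    finally have "4 / \<rho>\<^sup>2 * norm (q \<rho> z - 2 *\<^sub>R q (3/2 * \<rho>) z + q (2 * \<rho>) z) \<le> 4 / \<rho>\<^sup>2 * (2 * \<rho>)"
      by (intro mult_left_mono) auto
    then have "norm (D z) \<le> 8 / \<rho>" using assms by (simp add: D_def power2_eq_square)
    then show ?thesis using c by simp
  qed
  have taylor: "\<bar>\<psi> w - \<psi> z - D z \<bullet> (w - z)\<bar> \<le> 8 / \<rho>\<^sup>2 * (norm (w - z))\<^sup>2" for z w
  proof -
    define E where "E r = k r w - k r z - 2 * (q r z \<bullet> (w - z))" for r
    have "\<psi> w - \<psi> z - D z \<bullet> (w - z) = - (2 / \<rho>\<^sup>2 * (E \<rho> - 2 * E (3/2 * \<rho>) + E (2 * \<rho>)))"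
      using assms by (simp add: \<psi>_def D_def E_def inner_add_left inner_diff_left field_simps)
    then have "\<bar>\<psi> w - \<psi> z - D z \<bullet> (w - z)\<bar> = 2 / \<rho>\<^sup>2 * \<bar>E \<rho> - 2 * E (3/2 * \<rho>) + E (2 * \<rho>)\<bar>"
      by (simp only: abs_minus_cancel abs_mult) simp
    also have "\<dots> \<le> 2 / \<rho>\<^sup>2 * (4 * (norm (w - z))\<^sup>2)"
      using kt[of \<rho> w z] kt[of "3/2 * \<rho>" w z] kt[of "2 * \<rho>" w z] assms unfolding E_def[symmetric]
      by (intro mult_left_mono) auto
    finally show ?thesis by simp
  qed
  have lip: "\<bar>\<psi> w - \<psi> z\<bar> \<le> K * norm (w - z)" if "norm (w - z) \<le> 1" for z w
  proof -
    have "\<bar>D z \<bullet> (w - z)\<bar> \<le> norm (D z) * norm (w - z)" by (rule Cauchy_Schwarz_ineq2)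
    also have "\<dots> \<le> 8 / \<rho> * norm (w - z)" using bound by (intro mult_right_mono) auto
    finally have 1: "\<bar>D z \<bullet> (w - z)\<bar> \<le> 8 / \<rho> * norm (w - z)" .
    have "(norm (w - z))\<^sup>2 \<le> norm (w - z)" using that by (simp add: power2_eq_square mult_left_le)
    then have "8 / \<rho>\<^sup>2 * (norm (w - z))\<^sup>2 \<le> 8 / \<rho>\<^sup>2 * norm (w - z)" by (intro mult_left_mono) auto
    then have "\<bar>\<psi> w - \<psi> z\<bar> \<le> 8 / \<rho> * norm (w - z) + 8 / \<rho>\<^sup>2 * norm (w - z)" using taylor[of w z] 1 by linarith
    also have "\<dots> \<le> K * norm (w - z)" by (simp add: K_def algebra_simps)
    finally show ?thesis .
  qed
  have "\<bar>\<psi> z\<bar> \<le> K" for z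
  proof -
    have "4 \<le> K" using assms by (simp add: K_def)
    then show ?thesis using bound[of z] by linarith
  qed
  moreover have "\<bar>\<psi> w - \<psi> z - D z \<bullet> (w - z)\<bar> \<le> K * (norm (w - z))\<^sup>2" for z w
  proof -
    have "8 / \<rho>\<^sup>2 * (norm (w - z))\<^sup>2 \<le> K * (norm (w - z))\<^sup>2"
      using assms by (intro mult_right_mono) (auto simp: K_def)
    then show ?thesis using taylor[of w z] by linarith
  qed
  ultimately show thesis using that[of K \<psi> D] K inner1 outer lip by blast
qed

text \<open>G may grow linearly, but its size enters only through the remainder of the cutoff at z.
  If z lies beyond radius 2 \<rho> + 1, then w, at distance at most 1, lies beyond 2 \<rho> as well
  and that term vanishes; this is the origin of the summand with 2 \<rho> + 1.\<close>

lemma taylor_on_cutoff_product: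
  fixes \<psi> :: "'a::real_inner \<Rightarrow> real" and G :: "'a \<Rightarrow> 'b::real_normed_vector" and B :: "'a \<Rightarrow> 'a \<Rightarrow>\<^sub>L 'b"
  assumes K: "K \<ge> 0" and "\<rho> > 0" and "\<alpha> \<le> 1" and "l \<ge> 0" and "C \<ge> 0"
    and out: "\<And>z. norm z \<ge> 2 * \<rho> \<Longrightarrow> \<psi> z = 0 \<and> D z = 0"
    and bd: "\<And>z. \<bar>\<psi> z\<bar> \<le> K" and \<psi>lip: "\<And>z w. norm (w - z) \<le> 1 \<Longrightarrow> \<bar>\<psi> w - \<psi> z\<bar> \<le> K * norm (w - z)"
    and \<psi>t: "\<And>z w. \<bar>\<psi> w - \<psi> z - D z \<bullet> (w - z)\<bar> \<le> K * (norm (w - z))\<^sup>2"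
    and lip: "\<And>z w. norm (G w - G z) \<le> l * norm (w - z)"
    and taylor: "\<And>z w. norm (G w - G z - B z (w - z)) \<le> C * norm (w - z) powr (1 + \<alpha>)"
    and M: "norm (G 0) \<le> M"
  shows "taylor_on T \<alpha> (K * l + K * C + K * (M + l * (2 * \<rho> + 1))) (\<lambda>z. \<psi> z *\<^sub>R G z)
    (\<lambda>z v. (D z \<bullet> v) *\<^sub>R G z + \<psi> z *\<^sub>R B z v)"
  unfolding taylor_on_def
proof (intro conjI ballI impI)
  fix z
  show "bounded_linear (\<lambda>v. (D z \<bullet> v) *\<^sub>R G z + \<psi> z *\<^sub>R B z v)"
    by (intro bounded_linear_intros)
  fix w assume h: "norm (w - z) \<le> 1"
  define t where "t = norm (w - z)"
  have M0: "M \<ge> 0" using M norm_ge_zero order_trans by blast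
  have t: "0 \<le> t" "t \<le> 1" using h by (auto simp: t_def)
  have sq: "t\<^sup>2 \<le> t powr (1 + \<alpha>)"
  proof (cases "t = 0")
    case False
    then have "t\<^sup>2 = t powr 2" using t by simp
    also have "\<dots> \<le> t powr (1 + \<alpha>)" using t \<open>\<alpha> \<le> 1\<close> by (intro powr_mono') auto
    finally show ?thesis .
  qed simp
  have 1: "norm ((\<psi> w - \<psi> z) *\<^sub>R (G w - G z)) \<le> K * l * t powr (1 + \<alpha>)"
  proof -
    have "norm ((\<psi> w - \<psi> z) *\<^sub>R (G w - G z)) \<le> (K * t) * (l * t)"
      unfolding norm_scaleR real_norm_def using \<psi>lip[OF h] lip[of w z] K t
      by (intro mult_mono) (auto simp: t_def)
    also have "\<dots> = K * l * t\<^sup>2" by (simp add: power2_eq_square)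
    also have "\<dots> \<le> K * l * t powr (1 + \<alpha>)" using sq K \<open>l \<ge> 0\<close> by (intro mult_left_mono) auto
    finally show ?thesis .
  qed
  have 2: "norm (\<psi> z *\<^sub>R (G w - G z - B z (w - z))) \<le> K * C * t powr (1 + \<alpha>)"
  proof -
    have "norm (\<psi> z *\<^sub>R (G w - G z - B z (w - z))) \<le> K * (C * t powr (1 + \<alpha>))"
      unfolding norm_scaleR real_norm_def using bd[of z] taylor[of w z] K
      by (intro mult_mono) (auto simp: t_def)
    then show ?thesis by simp
  qed
  have 3: "norm ((\<psi> w - \<psi> z - D z \<bullet> (w - z)) *\<^sub>R G z) \<le> K * (M + l * (2 * \<rho> + 1)) * t powr (1 + \<alpha>)"
  proof (cases "norm z \<le> 2 * \<rho> + 1")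
    case True
    have "norm (G z) \<le> norm (G 0) + norm (G z - G 0)" by norm
    also have "\<dots> \<le> M + l * norm z" using M lip[of z 0] by simp
    also have "\<dots> \<le> M + l * (2 * \<rho> + 1)" using True \<open>l \<ge> 0\<close> by (intro add_left_mono mult_left_mono) auto
    finally have "norm ((\<psi> w - \<psi> z - D z \<bullet> (w - z)) *\<^sub>R G z) \<le> (K * t\<^sup>2) * (M + l * (2 * \<rho> + 1))"
      unfolding norm_scaleR real_norm_def using \<psi>t[of w z] K by (intro mult_mono) (auto simp: t_def)
    also have "\<dots> = (K * (M + l * (2 * \<rho> + 1))) * t\<^sup>2" by simp
    also have "\<dots> \<le> (K * (M + l * (2 * \<rho> + 1))) * t powr (1 + \<alpha>)"
      using sq K M0 \<open>l \<ge> 0\<close> \<open>\<rho> > 0\<close> by (intro mult_left_mono) auto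
    finally show ?thesis .
  next
    case False
    have "norm z \<le> norm w + norm (w - z)" by norm
    then have "norm w \<ge> 2 * \<rho>" using False h by linarith
    then show ?thesis using out[of w] out[of z] False K M0 \<open>l \<ge> 0\<close> \<open>\<rho> > 0\<close> by simp
  qed
  have "\<psi> w *\<^sub>R G w - \<psi> z *\<^sub>R G z - ((D z \<bullet> (w - z)) *\<^sub>R G z + \<psi> z *\<^sub>R B z (w - z))
      = (\<psi> w - \<psi> z) *\<^sub>R (G w - G z) + \<psi> z *\<^sub>R (G w - G z - B z (w - z)) + (\<psi> w - \<psi> z - D z \<bullet> (w - z)) *\<^sub>R G z"
    by (simp add: algebra_simps)
  also have "norm \<dots> \<le> norm ((\<psi> w - \<psi> z) *\<^sub>R (G w - G z)) + norm (\<psi> z *\<^sub>R (G w - G z - B z (w - z)))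
      + norm ((\<psi> w - \<psi> z - D z \<bullet> (w - z)) *\<^sub>R G z)"
    by (meson norm_triangle_ineq order_trans add_right_mono)
  also have "\<dots> \<le> (K * l + K * C + K * (M + l * (2 * \<rho> + 1))) * t powr (1 + \<alpha>)"
    using 1 2 3 by (simp add: distrib_right)
  finally show "norm (\<psi> w *\<^sub>R G w - \<psi> z *\<^sub>R G z - ((D z \<bullet> (w - z)) *\<^sub>R G z + \<psi> z *\<^sub>R B z (w - z)))
      \<le> (K * l + K * C + K * (M + l * (2 * \<rho> + 1))) * norm (w - z) powr (1 + \<alpha>)"
    by (simp add: t_def)
qed

section \<open>Convergence\<close>

text \<open>Walk a length t along v on the first graph and pass to a nearby point of the second set.
  Each graph leaves its plane only by order \<open>t powr (1 + \<alpha>)\<close>, so the step u lies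
  within 2 \<epsilon> + 17 L \<open>t powr (1 + \<alpha>)\<close> of the second plane, up to which
  it remains to divide by t. The bound \<epsilon> is the same for all sets and points.\<close>

lemma C1a_chart_tangent_close:
  fixes \<alpha> L R \<delta> :: real
  assumes \<alpha>: "0 < \<alpha>" "\<alpha> \<le> 1" and L: "L \<ge> 0" and R: "R > 0" and \<delta>: "\<delta> > 0"
  obtains \<epsilon> where "\<epsilon> > 0"
    "\<And>(\<Sigma> :: 'a::euclidean_space set) \<Sigma>' x y P g A Q h B v.
      C1a_chart \<alpha> L R \<Sigma> x P g A \<Longrightarrow> C1a_chart \<alpha> L R \<Sigma>' y Q h B \<Longrightarrow> dist x y < \<epsilon> \<Longrightarrow>
      (\<forall>p\<in>\<Sigma>. \<exists>q\<in>\<Sigma>'. dist p q < \<epsilon>) \<Longrightarrow> v \<in> range P \<Longrightarrow> norm (v - Q v) \<le> \<delta> * norm v"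
proof -
  \<comment> \<open>17 = 1 + 16: \<open>g\<close> at length t, and \<open>h\<close> at a parameter
    of length at most 4 t, with \<open>4 powr (1 + \<alpha>)\<close> at most 16. The other half of
    \<delta> is left for \<epsilon>.\<close>
  obtain t0 where t0: "0 < t0" "t0 \<le> 1/2" "17 * L * t0 powr \<alpha> \<le> \<delta> / 2"
    using small_powr[of \<alpha> "\<delta>/2" "17 * L"] \<alpha> L \<delta> by auto
  \<comment> \<open>p and q will lie within 2 t and 4 t of their base points; R / 8 keeps them in
    the chart balls.\<close>
  define t where "t = min t0 (R / 8)"
  have t: "0 < t" "8 * t \<le> R" "t \<le> t0" using t0 R by (auto simp: t_def)
  have "17 * L * t powr \<alpha> \<le> 17 * L * t0 powr \<alpha>" using t L \<alpha> by (intro mult_left_mono powr_mono2) auto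
  then have tL: "17 * L * t powr \<alpha> \<le> \<delta> / 2" using t0 by linarith
  define \<epsilon> where "\<epsilon> = min t (\<delta> * t / 4)"
  have e: "\<epsilon> > 0" "\<epsilon> \<le> t" "\<epsilon> \<le> \<delta> * t / 4" using t \<delta> by (auto simp: \<epsilon>_def)
  show thesis
  proof (rule that[OF e(1)])
    fix \<Sigma> \<Sigma>' :: "'a set" and x y P g A Q h B v
    assume c: "C1a_chart \<alpha> L R \<Sigma> x P g A" and c': "C1a_chart \<alpha> L R \<Sigma>' y Q h B"
      and xy: "dist x y < \<epsilon>" and near: "\<forall>p\<in>\<Sigma>. \<exists>q\<in>\<Sigma>'. dist p q < \<epsilon>" and v: "v \<in> range P"
    note P = C1a_chart_oproj[OF c] and Q = C1a_chart_oproj[OF c']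
    show "norm (v - Q v) \<le> \<delta> * norm v"
    proof (cases "v = 0")
      case True
      then show ?thesis by (simp add: blinfun.zero_right)
    next
      case False
      define u where "u = (t / norm v) *\<^sub>R v"
      have nu: "norm u = t" using False t by (simp add: u_def)
      have Pu: "P u = u" using v oproj_range_iff[OF P] by (simp add: u_def blinfun.scaleR_right)
      define p where "p = x + (P u + g u)"
      have gu: "norm (g u) \<le> L * t powr (1 + \<alpha>)"
        using C1a_chart_taylor[OF c, of u 0] by (simp add: nu C1a_chart_zero[OF c] C1a_chart_deriv_zero[OF c])
      have "norm (g u) \<le> t" using C1a_chart_lipschitz[OF c, of u 0] by (simp add: nu C1a_chart_zero[OF c])
      then have px: "norm (p - x) \<le> 2 * t" using norm_triangle_ineq[of u "g u"] nu by (simp add: p_def Pu)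
      have "p \<in> (+) x ` range (\<lambda>z. P z + g z)" unfolding p_def by blast
      moreover have "p \<in> ball x R" using px t by (simp add: dist_norm norm_minus_commute[of x])
      ultimately have "p \<in> ((+) x ` range (\<lambda>z. P z + g z)) \<inter> ball x R" by (rule IntI)
      then have "p \<in> \<Sigma>" unfolding C1a_chart_graph[OF c, symmetric] by simp
      then obtain q where q: "q \<in> \<Sigma>'" "norm (p - q) < \<epsilon>" using near by (auto simp: dist_norm)
      have xy': "norm (x - y) < \<epsilon>" using xy by (simp add: dist_norm)
      have "norm (q - y) \<le> norm (p - q) + norm (p - x) + norm (x - y)" by norm
      then have qy: "norm (q - y) \<le> 4 * t" using q(2) px xy' e(2) by linarith
      define \<eta> where "\<eta> = Q (q - y)"
      have "dist y q < R" using qy t by (simp add: dist_norm norm_minus_commute)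
      from C1a_chart_param[OF c' q(1) this] have q_eq: "q - y = \<eta> + h \<eta>"
        by (simp add: \<eta>_def C1a_chart_proj[OF c'] algebra_simps)
      have n\<eta>: "norm \<eta> \<le> 4 * t" using oproj_norm_le[OF Q, of "q - y"] qy by (simp add: \<eta>_def)
      have "norm (h \<eta>) \<le> L * norm \<eta> powr (1 + \<alpha>)"
        using C1a_chart_taylor[OF c', of \<eta> 0] by (simp add: C1a_chart_zero[OF c'] C1a_chart_deriv_zero[OF c'])
      also have "\<dots> \<le> L * (4 * t) powr (1 + \<alpha>)"
        using n\<eta> L \<alpha> by (intro mult_left_mono powr_mono2) auto
      also have "\<dots> \<le> L * (4 powr 2 * t powr (1 + \<alpha>))"
        unfolding powr_mult using L \<alpha> by (intro mult_left_mono mult_right_mono powr_mono) auto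
      finally have h\<eta>: "norm (h \<eta>) \<le> 16 * (L * t powr (1 + \<alpha>))" by simp
      have "u - \<eta> = (p - q) - (x - y) - g u + h \<eta>"
        using q_eq by (simp add: p_def Pu algebra_simps)
      also have "norm \<dots> \<le> norm (p - q) + norm (x - y) + norm (g u) + norm (h \<eta>)" by norm
      also have "\<dots> \<le> 2 * \<epsilon> + 17 * (L * t powr (1 + \<alpha>))" using q(2) xy' gu h\<eta> by linarith
      also have "\<dots> = 2 * \<epsilon> + t * (17 * L * t powr \<alpha>)" using t by (simp add: powr_add)
      also have "\<dots> \<le> 2 * (\<delta> * t / 4) + t * (\<delta> / 2)"
        using e(3) tL t(1) by (intro add_mono mult_left_mono) auto
      finally have u\<eta>: "norm (u - \<eta>) \<le> t * \<delta>" by (simp add: mult.commute)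
      have "Q \<eta> = \<eta>" by (simp add: \<eta>_def oproj_idem[OF Q])
      then have uQ: "u - Q u = (u - \<eta>) - Q (u - \<eta>)" by (simp add: blinfun.diff_right)
      have "norm (u - Q u) \<le> t * \<delta>" unfolding uQ using oproj_compl_norm_le[OF Q, of "u - \<eta>"] u\<eta> by linarith
      moreover have "u - Q u = (t / norm v) *\<^sub>R (v - Q v)"
        by (simp add: u_def blinfun.scaleR_right scaleR_diff_right)
      then have "norm (u - Q u) = t * (norm (v - Q v) / norm v)" using t by simp
      ultimately have "norm (v - Q v) / norm v \<le> \<delta>" using t(1) by (metis mult_le_cancel_left_pos)
      then show ?thesis using False pos_divide_le_eq[of "norm v"] by simp
    qed
  qed
qed

lemma Int_eq_on_subset: "A \<inter> V = B \<inter> V \<Longrightarrow> U \<subseteq> V \<Longrightarrow> A \<inter> U = B \<inter> U"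
  by blast

text \<open>The offset \<open>a = y - x\<close> moves the graph from its base point y to x, and the
  ball of radius R / 2 about x lies inside the chart ball about y.\<close>

lemma C1a_chart_regraph:
  fixes \<Sigma> :: "'a::euclidean_space set"
  assumes \<alpha>: "0 < \<alpha>" "\<alpha> \<le> 1" and L: "L \<ge> 0" and P: "oproj P"
    and ch: "C1a_chart \<alpha> L R \<Sigma> y Q h B" and xy: "dist x y < R / 2" and PQ: "norm (P - Q) \<le> 1/6"
  shows "\<exists>F E. (\<forall>\<zeta>. P (F \<zeta>) = 0) \<and>
    \<Sigma> \<inter> ball x (R / 2) = ((+) x ` graph_over (range P) F) \<inter> ball x (R / 2) \<and>
    (\<forall>\<zeta> \<eta>. norm (F \<eta> - F \<zeta>) \<le> 4 * norm (\<eta> - \<zeta>)) \<and>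
    (\<forall>\<zeta> \<eta>. norm (F \<eta> - F \<zeta> - blinfun_apply (E \<zeta>) (\<eta> - \<zeta>)) \<le> 8 * L * norm (\<eta> - \<zeta>) powr (1 + \<alpha>))"
proof -
  obtain F E where F: "\<And>\<zeta>. P (F \<zeta>) = 0"
    "(\<lambda>\<zeta>. \<zeta> + F \<zeta>) ` range P = range (\<lambda>z. (y - x) + (Q z + h z))"
    "\<And>\<zeta> \<eta>. norm (F \<eta> - F \<zeta>) \<le> 4 * norm (\<eta> - \<zeta>)"
    "\<And>\<zeta> \<eta>. norm (F \<eta> - F \<zeta> - blinfun_apply (E \<zeta>) (\<eta> - \<zeta>)) \<le> 8 * L * norm (\<eta> - \<zeta>) powr (1 + \<alpha>)"
    by (rule regraph[where a = "y - x", OF P C1a_chart_oproj[OF ch] PQ C1a_chart_proj[OF ch] C1a_chart_normal[OF ch]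
          C1a_chart_lipschitz[OF ch] C1a_chart_deriv_le[OF ch \<alpha>(1)] C1a_chart_taylor[OF ch] \<alpha> L]) blast
  have gr: "(+) x ` graph_over (range P) F = (+) y ` range (\<lambda>z. Q z + h z)"
    unfolding graph_over_def F(2) by (simp add: image_image add.assoc[symmetric])
  have sub: "ball x (R / 2) \<subseteq> ball y R"
  proof
    fix w assume "w \<in> ball x (R / 2)"
    then show "w \<in> ball y R" using xy dist_triangle[of y w x] by (simp add: dist_commute)
  qed
  have "\<Sigma> \<inter> ball x (R / 2) = ((+) x ` graph_over (range P) F) \<inter> ball x (R / 2)"
    unfolding gr by (rule Int_eq_on_subset[OF C1a_chart_graph[OF ch] sub])
  then show ?thesis using F(1,3,4) by blast
qed

text \<open>The final charts are \<open>g + H j\<close> with \<open>H j\<close> the cut off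
  difference: they agree with \<open>F j\<close> up to radius R / 16 and with \<open>g\<close> from
  R / 8 on. Convergence then concerns \<open>H j\<close> alone, whose expansion constant is
  independent of j.\<close>

lemma C1a_chart_local_convergence:
  fixes S :: "nat \<Rightarrow> 'a::euclidean_space set"
  assumes \<alpha>: "0 < \<alpha>" "\<alpha> \<le> 1" and L: "L \<ge> 0" and R: "R > 0"
    and ch: "C1a_chart \<alpha> L R S0 x P g A" and hc: "hausdorff_conv S S0"
    and near: "\<And>j p. j \<ge> j0 \<Longrightarrow> p \<in> S0 \<Longrightarrow> \<exists>q\<in>S j. dist p q < R / 8"
    and charts: "\<And>j. j \<ge> j0 \<Longrightarrow> \<exists>y Q h B. C1a_chart \<alpha> L R (S j) y Q h B \<and> dist x y < R / 2 \<and> norm (P - Q) \<le> 1/6"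
  shows "\<exists>F DF F0 DF0. C1a_on (range P) \<alpha> F0 DF0 \<and>
     S0 \<inter> ball x (R / 16) = ((+) x ` graph_over (range P) F0) \<inter> ball x (R / 16) \<and>
     (\<forall>j\<ge>j0. C1a_on (range P) \<alpha> (F j) (DF j) \<and>
        S j \<inter> ball x (R / 16) = ((+) x ` graph_over (range P) (F j)) \<inter> ball x (R / 16)) \<and>
     (\<forall>\<beta>. 0 < \<beta> \<and> \<beta> < \<alpha> \<longrightarrow>
        C1a_norm_tendsto_zero (range P) \<beta> (\<lambda>j \<xi>. F j \<xi> - F0 \<xi>) (\<lambda>j \<xi> v. DF j \<xi> v - DF0 \<xi> v))"
proof -
  note P = C1a_chart_oproj[OF ch]
  have T: "subspace (range P)" by (rule subspace_range_blinfun)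
  have "\<forall>j. \<exists>F E. j \<ge> j0 \<longrightarrow> (\<forall>\<zeta>. P (F \<zeta>) = 0) \<and>
    S j \<inter> ball x (R / 2) = ((+) x ` graph_over (range P) F) \<inter> ball x (R / 2) \<and>
    (\<forall>\<zeta> \<eta>. norm (F \<eta> - F \<zeta>) \<le> 4 * norm (\<eta> - \<zeta>)) \<and>
    (\<forall>\<zeta> \<eta>. norm (F \<eta> - F \<zeta> - blinfun_apply (E \<zeta>) (\<eta> - \<zeta>)) \<le> 8 * L * norm (\<eta> - \<zeta>) powr (1 + \<alpha>))"
    using charts C1a_chart_regraph[OF \<alpha> L P] by meson
  then obtain F E where FE: "\<forall>j. j \<ge> j0 \<longrightarrow> (\<forall>\<zeta>. P (F j \<zeta>) = 0) \<and>
    S j \<inter> ball x (R / 2) = ((+) x ` graph_over (range P) (F j)) \<inter> ball x (R / 2) \<and>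
    (\<forall>\<zeta> \<eta>. norm (F j \<eta> - F j \<zeta>) \<le> 4 * norm (\<eta> - \<zeta>)) \<and>
    (\<forall>\<zeta> \<eta>. norm (F j \<eta> - F j \<zeta> - blinfun_apply (E j \<zeta>) (\<eta> - \<zeta>)) \<le> 8 * L * norm (\<eta> - \<zeta>) powr (1 + \<alpha>))"
    unfolding choice_iff by blast
  have PF: "P (F j \<zeta>) = 0" and Fgr: "S j \<inter> ball x (R / 2) = ((+) x ` graph_over (range P) (F j)) \<inter> ball x (R / 2)"
    and Flip: "norm (F j \<eta> - F j \<zeta>) \<le> 4 * norm (\<eta> - \<zeta>)"
    and Ft: "norm (F j \<eta> - F j \<zeta> - E j \<zeta> (\<eta> - \<zeta>)) \<le> 8 * L * norm (\<eta> - \<zeta>) powr (1 + \<alpha>)"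
    if "j \<ge> j0" for j \<zeta> \<eta>
    using FE that by auto
  define \<rho> where "\<rho> = R / 16"
  have \<rho>: "\<rho> > 0" using R by (simp add: \<rho>_def)
  define G where "G j z = F j z - g z" for j z
  have Glip: "norm (G j w - G j z) \<le> 5 * norm (w - z)" if "j \<ge> j0" for j w z
  proof -
    have "norm (G j w - G j z) \<le> norm (F j w - F j z) + norm (g w - g z)" unfolding G_def by norm
    then show ?thesis using Flip[OF that, of w z] C1a_chart_lipschitz[OF ch, of w z] by linarith
  qed
  have Gt: "norm (G j w - G j z - (E j z - A z) (w - z)) \<le> 9 * L * norm (w - z) powr (1 + \<alpha>)" if "j \<ge> j0" for j w z
  proof -
    have "G j w - G j z - (E j z - A z) (w - z) = (F j w - F j z - E j z (w - z)) - (g w - g z - A z (w - z))"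
      by (simp add: G_def blinfun.diff_left)
    then have "norm (G j w - G j z - (E j z - A z) (w - z))
        \<le> norm (F j w - F j z - E j z (w - z)) + norm (g w - g z - A z (w - z))" by (metis norm_triangle_ineq4)
    then show ?thesis using Ft[OF that, of w z] C1a_chart_taylor[OF ch, of w z] by linarith
  qed
  \<comment> \<open>Take p on \<open>S0\<close> over \<xi> and q on \<open>S j\<close> near p, over
    \<zeta>. P and its complement bound \<xi> - \<zeta> and \<open>g \<xi> - F j \<zeta>\<close> by
    e, and the Lipschitz constant 4 of \<open>F j\<close> brings \<zeta> back to \<xi>: 4 e + e. As
    p is within R / 4 of x and e is at most R / 8, q stays where \<open>S j\<close> is a
    graph.\<close>
  have close: "norm (G j \<xi>) \<le> 5 * e"
    if j: "j \<ge> j0" and e: "e \<le> R / 8" and n: "\<forall>p\<in>S0. \<exists>q\<in>S j. dist p q < e" and \<xi>: "\<xi> \<in> range P" "norm \<xi> \<le> 2 * \<rho>" for j e \<xi>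
  proof -
    have P\<xi>: "P \<xi> = \<xi>" using \<xi>(1) oproj_range_iff[OF P] by blast
    define p where "p = x + (P \<xi> + g \<xi>)"
    have "norm (g \<xi>) \<le> norm \<xi>" using C1a_chart_lipschitz[OF ch, of \<xi> 0] by (simp add: C1a_chart_zero[OF ch])
    then have px: "norm (p - x) \<le> R / 4"
      using norm_triangle_ineq[of \<xi> "g \<xi>"] \<xi>(2) by (simp add: p_def P\<xi> \<rho>_def)
    have "p \<in> (+) x ` range (\<lambda>z. P z + g z)" unfolding p_def by blast
    moreover have "p \<in> ball x R" using px R by (simp add: dist_norm norm_minus_commute[of x])
    ultimately have "p \<in> ((+) x ` range (\<lambda>z. P z + g z)) \<inter> ball x R" by (rule IntI)
    then have "p \<in> S0" unfolding C1a_chart_graph[OF ch, symmetric] by simp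
    then obtain q where q: "q \<in> S j" "norm (p - q) < e" using n by (auto simp: dist_norm)
    have "norm (q - x) \<le> norm (p - q) + norm (p - x)" by norm
    then have "norm (q - x) < R / 2" using q px e R by linarith
    then have "q \<in> S j \<inter> ball x (R / 2)" using q by (simp add: dist_norm norm_minus_commute)
    then obtain \<zeta> where \<zeta>: "\<zeta> \<in> range P" "q = x + (\<zeta> + F j \<zeta>)"
      unfolding Fgr[OF j] graph_over_def by blast
    have P\<zeta>: "P \<zeta> = \<zeta>" using \<zeta>(1) oproj_range_iff[OF P] by blast
    have pq: "P (p - q) = \<xi> - \<zeta>"
      by (simp add: p_def \<zeta>(2) blinfun.add_right blinfun.diff_right P\<xi> P\<zeta> PF[OF j] C1a_chart_normal[OF ch])
    then have 1: "norm (\<xi> - \<zeta>) \<le> e" using oproj_norm_le[OF P, of "p - q"] q(2) by simp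
    have "(p - q) - P (p - q) = g \<xi> - F j \<zeta>" unfolding pq by (simp add: p_def \<zeta>(2) P\<xi>)
    then have 2: "norm (g \<xi> - F j \<zeta>) \<le> e" using oproj_compl_norm_le[OF P, of "p - q"] q(2) by simp
    have "norm (G j \<xi>) \<le> norm (F j \<xi> - F j \<zeta>) + norm (g \<xi> - F j \<zeta>)" unfolding G_def by norm
    then show ?thesis using Flip[OF j, of \<xi> \<zeta>] 1 2 by linarith
  qed
  obtain \<psi> :: "'a \<Rightarrow> real" and D K where K: "K \<ge> 0" and \<psi>1: "\<And>z. norm z \<le> \<rho> \<Longrightarrow> \<psi> z = 1"
    and \<psi>0: "\<And>z. norm z \<ge> 2 * \<rho> \<Longrightarrow> \<psi> z = 0 \<and> D z = 0" and \<psi>K: "\<And>z. \<bar>\<psi> z\<bar> \<le> K"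
    and \<psi>lip: "\<And>z w. norm (w - z) \<le> 1 \<Longrightarrow> \<bar>\<psi> w - \<psi> z\<bar> \<le> K * norm (w - z)"
    and \<psi>t: "\<And>z w. \<bar>\<psi> w - \<psi> z - D z \<bullet> (w - z)\<bar> \<le> K * (norm (w - z))\<^sup>2"
    using cutoff_exists[OF \<rho>] by metis
  define H where "H j z = \<psi> z *\<^sub>R G j z" for j z
  define DH where "DH j z v = (D z \<bullet> v) *\<^sub>R G j z + \<psi> z *\<^sub>R (E j z - A z) v" for j z v
  have Hle: "norm (H j z) \<le> K * (5 * e)"
    if j: "j \<ge> j0" and e: "e \<le> R / 8" "e \<ge> 0" and n: "\<forall>p\<in>S0. \<exists>q\<in>S j. dist p q < e" and z: "z \<in> range P" for j e z
  proof (cases "norm z \<le> 2 * \<rho>")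
    case True
    then show ?thesis unfolding H_def norm_scaleR real_norm_def
      using close[OF j e(1) n z True] \<psi>K K by (intro mult_mono) auto
  next
    case False
    then show ?thesis using \<psi>0[of z] K e by (simp add: H_def)
  qed
  \<comment> \<open>The estimate \<open>close\<close> with e = R / 8, the closeness available for
    every j from \<open>j0\<close> on.\<close>
  define M where "M = 5 * (R / 8)"
  have GM: "norm (G j 0) \<le> M" if "j \<ge> j0" for j
    unfolding M_def by (rule close[OF that order.refl]) (use near that \<rho> subspace_0[OF T] in auto)
  have HM: "norm (H j z) \<le> K * M" if "j \<ge> j0" "z \<in> range P" for j z
    unfolding M_def by (rule Hle[OF that(1) order.refl _ _ that(2)]) (use near that R in auto)
  \<comment> \<open>The differences \<open>G j\<close> inherit 5 = 4 + 1 and 9 L = 8 L + L from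
    \<open>F j\<close> and \<open>g\<close>.\<close>
  define C where "C = K * 5 + K * (9 * L) + K * (M + 5 * (2 * \<rho> + 1))"
  have C: "C \<ge> 0" using K L R \<rho> by (simp add: C_def M_def)
  have Ht: "taylor_on (range P) \<alpha> C (H j) (DH j)" if "j \<ge> j0" for j
    unfolding C_def H_def[abs_def] DH_def[abs_def]
    by (rule taylor_on_cutoff_product[OF K \<rho> \<alpha>(2) _ _ \<psi>0 \<psi>K \<psi>lip \<psi>t Glip[OF that] Gt[OF that] GM[OF that]])
      (use L in auto)
  have PH: "P (H j z) = 0" if "j \<ge> j0" for j z
    using PF[OF that] C1a_chart_normal[OF ch] by (simp add: H_def G_def blinfun.scaleR_right blinfun.diff_right)
  have C1: "C1a_on (range P) \<alpha> (\<lambda>z. g z + H j z) (\<lambda>z v. A z v + DH j z v)" if "j \<ge> j0" for j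
    by (rule C1a_on_add_taylor[OF T \<alpha> C C1a_chart_C1a_on[OF ch \<alpha>(1)] Ht[OF that] HM[OF that]])
      (simp_all add: orthogonal_comp_oproj_iff[OF P] PH[OF that])
  \<comment> \<open>A graph point within \<rho> of x has a parameter of norm at most \<rho>, where
    the cutoff equals 1; so the cutoff leaves the graph in that ball unchanged.\<close>
  have small: "norm \<xi> \<le> norm (\<xi> + f)" if "\<xi> \<in> range P" "P f = 0" for \<xi> f
    using oproj_norm_le[OF P, of "\<xi> + f"] that oproj_range_iff[OF P, of \<xi>] by (simp add: blinfun.add_right)
  have gr: "S j \<inter> ball x (R / 16) = ((+) x ` graph_over (range P) (\<lambda>z. g z + H j z)) \<inter> ball x (R / 16)"
    if j: "j \<ge> j0" for j
  proof -
    have eq: "g \<xi> + H j \<xi> = F j \<xi>" if "norm \<xi> \<le> \<rho>" for \<xi>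
      using \<psi>1[OF that] by (simp add: H_def G_def)
    have "((+) x ` graph_over (range P) (F j)) \<inter> ball x \<rho> = ((+) x ` graph_over (range P) (\<lambda>z. g z + H j z)) \<inter> ball x \<rho>"
    proof (rule sym, intro set_eqI iffI; elim IntE)
      fix y assume "y \<in> (+) x ` graph_over (range P) (\<lambda>z. g z + H j z)" and yb: "y \<in> ball x \<rho>"
      then obtain \<xi> where \<xi>: "\<xi> \<in> range P" "y = x + (\<xi> + (g \<xi> + H j \<xi>))" by (auto simp only: graph_over_def)
      have "P (g \<xi> + H j \<xi>) = 0" using PH[OF j] C1a_chart_normal[OF ch] by (simp add: blinfun.add_right)
      then have "norm \<xi> \<le> norm (y - x)" using small[OF \<xi>(1)] by (simp add: \<xi>(2))
      then have "norm \<xi> \<le> \<rho>" using yb by (simp add: dist_norm norm_minus_commute)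
      then have "y = x + (\<xi> + F j \<xi>)" using \<xi>(2) eq by simp
      then show "y \<in> ((+) x ` graph_over (range P) (F j)) \<inter> ball x \<rho>"
        using \<xi>(1) yb unfolding graph_over_def by blast
    next
      fix y assume "y \<in> (+) x ` graph_over (range P) (F j)" and yb: "y \<in> ball x \<rho>"
      then obtain \<xi> where \<xi>: "\<xi> \<in> range P" "y = x + (\<xi> + F j \<xi>)" by (auto simp only: graph_over_def)
      have "norm \<xi> \<le> norm (y - x)" using small[OF \<xi>(1) PF[OF j]] by (simp add: \<xi>(2))
      then have "norm \<xi> \<le> \<rho>" using yb by (simp add: dist_norm norm_minus_commute)
      then have "y = x + (\<xi> + (g \<xi> + H j \<xi>))" using \<xi>(2) eq by simp
      then show "y \<in> ((+) x ` graph_over (range P) (\<lambda>z. g z + H j z)) \<inter> ball x \<rho>"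
        using \<xi>(1) yb unfolding graph_over_def by blast
    qed
    moreover have "ball x \<rho> \<subseteq> ball x (R / 2)" using R by (intro subset_ball) (simp add: \<rho>_def)
    then have "S j \<inter> ball x \<rho> = ((+) x ` graph_over (range P) (F j)) \<inter> ball x \<rho>"
      by (rule Int_eq_on_subset[OF Fgr[OF j]])
    ultimately show ?thesis unfolding \<rho>_def[symmetric] by (rule trans[rotated])
  qed
  have conv: "C1a_norm_tendsto_zero (range P) \<beta> H DH" if "0 < \<beta>" "\<beta> < \<alpha>" for \<beta>
  proof (rule C1a_norm_tendsto_zero_of_taylor[OF T that \<alpha>(2) C Ht])
    fix e :: real assume e: "e > 0"
    define e' where "e' = min (R / 8) (e / (5 * (K + 1)))"
    have e': "e' > 0" "e' \<le> R / 8" "e' \<le> e / (5 * (K + 1))"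
      unfolding e'_def using e R K by (simp_all only: min.cobounded1 min.cobounded2) simp
    have "K * (5 * e') \<le> (5 * (K + 1)) * e'" using e'(1) K by (simp add: algebra_simps)
    also have "\<dots> \<le> (5 * (K + 1)) * (e / (5 * (K + 1)))" using e'(3) K by (intro mult_left_mono) auto
    also have "\<dots> = e" using K by simp
    finally have Ke: "K * (5 * e') \<le> e" .
    from hc[unfolded hausdorff_conv_def, rule_format, OF e'(1)] eventually_ge_at_top[of j0]
    show "eventually (\<lambda>j. \<forall>z\<in>range P. norm (H j z) \<le> e) sequentially"
    proof eventually_elim
      case (elim j)
      show ?case
      proof
        fix z assume "z \<in> range P"
        then show "norm (H j z) \<le> e" using Hle[OF elim(2) e'(2), of z] elim(1) e'(1) Ke by fastforce
      qed
    qed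
  qed
  have "S0 \<inter> ball x (R / 16) = ((+) x ` graph_over (range P) g) \<inter> ball x (R / 16)"
  proof -
    have "ball x (R / 16) \<subseteq> ball x R" using R by (intro subset_ball) simp
    then show ?thesis by (rule Int_eq_on_subset[OF C1a_chart_graph_over[OF ch]])
  qed
  then show ?thesis
    using C1 gr conv
    by (intro exI[of _ "\<lambda>j z. g z + H j z"] exI[of _ "\<lambda>j z v. A z v + DH j z v"] exI[of _ g]
        exI[of _ "\<lambda>z. blinfun_apply (A z)"] conjI C1a_chart_C1a_on[OF ch \<alpha>(1)]) auto
qed

theorem mainTheorem4:
  fixes S :: "nat \<Rightarrow> 'a::euclidean_space set"
    and m :: nat and R L d \<alpha> :: real
  assumes "R > 0" and "L > 0" and "d > 0"
    and "0 < \<alpha>" and "\<alpha> \<le> 1"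
    and "\<And>j. C1a_class_RLd m \<alpha> R L d (S j)"
  shows "\<exists>r S0. strict_mono r \<and> C1a_class_RLd m \<alpha> R L d S0 \<and> C1a_converges m \<alpha> (S \<circ> r) S0"
proof (cases "infinite {j. S j = {}}")
  \<comment> \<open>The empty set satisfies the conditions of the class vacuously but is excluded
    from the selection theorem, so this case takes a constantly empty subsequence.\<close>
  case True
  then obtain r :: "nat \<Rightarrow> nat" where r: "strict_mono r" "\<And>n. S (r n) = {}"
    using infinite_enumerate[of "{j. S j = {}}"] by auto
  have cl: "C1a_class_RLd m \<alpha> R L d ({} :: 'a set)"
    using assms by (intro C1a_class_RLd_of_charts) auto
  have "C1a_converges m \<alpha> (S \<circ> r) {}"
    using r(2) unfolding C1a_converges_def hausdorff_conv_def C1a_submanifold_def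
    by (auto intro!: exI[of _ "1::real"])
  then show ?thesis using r(1) cl by blast
next
  case False
  then have "infinite {j. S j \<noteq> {}}"
    using finite_Collect_not infinite_UNIV_nat by (metis (full_types) Collect_neg_eq finite_compl)
  then obtain r1 :: "nat \<Rightarrow> nat" where r1: "strict_mono r1" "\<And>n. S (r1 n) \<noteq> {}"
    using infinite_enumerate[of "{j. S j \<noteq> {}}"] by auto
  have cpt: "compact (S j)" and sub: "S j \<subseteq> cball 0 d" for j
    using assms(6)[of j] by (auto simp: C1a_class_RLd_def C1a_class_def)
  obtain r2 S0 where r2: "strict_mono (r2 :: nat \<Rightarrow> nat)" and S0: "compact S0" "S0 \<subseteq> cball 0 d"
    and hc0: "hausdorff_conv ((S \<circ> r1) \<circ> r2) S0"
    by (rule blaschke_selection[of "S \<circ> r1" d]) (use r1 sub in auto)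
  define r where "r = r1 \<circ> r2"
  define U where "U = S \<circ> r"
  have r: "strict_mono r" unfolding r_def by (rule strict_mono_o[OF r1(1) r2])
  have hc: "hausdorff_conv U S0" using hc0 by (simp add: U_def r_def o_assoc)
  have Ucl: "C1a_class_RLd m \<alpha> R L d (U j)" and Une: "U j \<noteq> {}" and Ucpt: "compact (U j)" for j
    using assms(6) r1(2) cpt by (auto simp: U_def r_def)
  have L: "L \<ge> 0" using assms by simp
  have Uch: "\<exists>P g A. C1a_chart \<alpha> L R (U j) y P g A \<and> dim (range (blinfun_apply P)) = m" if "y \<in> U j" for j y
    using C1a_class_RLd_chart[OF Ucl that assms(4) L] by metis
  have ch0: "\<exists>P g A. C1a_chart \<alpha> L R S0 x P g A \<and> dim (range (blinfun_apply P)) = m" if "x \<in> S0" for x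
  proof -
    obtain y where y: "\<And>j. y j \<in> U j" "y \<longlonglongrightarrow> x"
      by (rule hausdorff_conv_approx[OF hc Ucpt Une \<open>x \<in> S0\<close>]) blast
    obtain P g A where c: "\<And>j. C1a_chart \<alpha> L R (U j) (y j) (P j) (g j) (A j)"
      "\<And>j. dim (range (blinfun_apply (P j))) = m"
      using Uch[OF y(1)] by metis
    show ?thesis
      by (rule C1a_chart_limit[OF assms(4) L c y(2) hc compact_imp_closed[OF S0(1)] Ucpt Une])
  qed
  have cl0: "C1a_class_RLd m \<alpha> R L d S0"
    by (rule C1a_class_RLd_of_charts[OF S0 assms(4,1) ch0])
  \<comment> \<open>The value 1/12 is half of the admissible 1/6, since the two directions of the
    estimate add up.\<close>
  obtain \<epsilon> where \<epsilon>: "\<epsilon> > 0" and tc: "\<And>(\<Sigma> :: 'a set) \<Sigma>' x y P g A Q h B v.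
      C1a_chart \<alpha> L R \<Sigma> x P g A \<Longrightarrow> C1a_chart \<alpha> L R \<Sigma>' y Q h B \<Longrightarrow> dist x y < \<epsilon> \<Longrightarrow>
      (\<forall>p\<in>\<Sigma>. \<exists>q\<in>\<Sigma>'. dist p q < \<epsilon>) \<Longrightarrow> v \<in> range P \<Longrightarrow> norm (v - Q v) \<le> 1/12 * norm v"
    by (rule C1a_chart_tangent_close[OF assms(4,5) L assms(1), of "1/12"]) auto
  \<comment> \<open>\<open>\<epsilon>'\<close> and the \<open>j0\<close> derived from it are fixed
    before a point x is chosen; this gives the uniformity in x.\<close>
  define \<epsilon>' where "\<epsilon>' = min \<epsilon> (R / 8)"
  have "\<epsilon>' > 0" using \<epsilon> assms(1) by (simp add: \<epsilon>'_def)
  from hc[unfolded hausdorff_conv_def, rule_format, OF this]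
  obtain j0 where j0: "\<And>j. j \<ge> j0 \<Longrightarrow> (\<forall>y\<in>U j. \<exists>z\<in>S0. dist y z < \<epsilon>') \<and> (\<forall>z\<in>S0. \<exists>y\<in>U j. dist z y < \<epsilon>')"
    unfolding eventually_sequentially by blast
  have loc: "\<exists>F DF F0 DF0. C1a_on (tangent_space S0 x) \<alpha> F0 DF0 \<and>
     S0 \<inter> ball x (R / 16) = ((+) x ` graph_over (tangent_space S0 x) F0) \<inter> ball x (R / 16) \<and>
     (\<forall>j\<ge>j0. C1a_on (tangent_space S0 x) \<alpha> (F j) (DF j) \<and>
        U j \<inter> ball x (R / 16) = ((+) x ` graph_over (tangent_space S0 x) (F j)) \<inter> ball x (R / 16)) \<and>
     (\<forall>\<beta>. 0 < \<beta> \<and> \<beta> < \<alpha> \<longrightarrow>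
        C1a_norm_tendsto_zero (tangent_space S0 x) \<beta> (\<lambda>j \<xi>. F j \<xi> - F0 \<xi>) (\<lambda>j \<xi> v. DF j \<xi> v - DF0 \<xi> v))"
    if x: "x \<in> S0" for x
  proof -
    obtain P g A where c: "C1a_chart \<alpha> L R S0 x P g A" using ch0[OF x] by blast
    have near: "\<exists>q\<in>U j. dist p q < R / 8" if "j \<ge> j0" "p \<in> S0" for j p
      using j0[OF that(1)] that(2) by (force simp: \<epsilon>'_def)
    have charts: "\<exists>y Q h B. C1a_chart \<alpha> L R (U j) y Q h B \<and> dist x y < R / 2 \<and> norm (P - Q) \<le> 1/6"
      if j: "j \<ge> j0" for j
    proof -
      obtain y where y: "y \<in> U j" "dist x y < \<epsilon>'" using j0[OF j] x by blast
      obtain Q h B where c': "C1a_chart \<alpha> L R (U j) y Q h B" using Uch[OF y(1)] by blast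
      have d: "dist x y < \<epsilon>" "dist y x < \<epsilon>" "dist x y < R / 2"
        using y(2) assms(1) by (auto simp: \<epsilon>'_def dist_commute)
      have n1: "\<forall>p\<in>S0. \<exists>q\<in>U j. dist p q < \<epsilon>" and n2: "\<forall>p\<in>U j. \<exists>q\<in>S0. dist p q < \<epsilon>"
        using j0[OF j] by (force simp: \<epsilon>'_def)+
      have "norm (P - Q) \<le> 2 * (1/12)"
        by (rule oproj_norm_diff_le[OF C1a_chart_oproj[OF c] C1a_chart_oproj[OF c']])
          (use tc[OF c c' d(1) n1] tc[OF c' c d(2) n2] in auto)
      then show ?thesis using c' d(3) by (intro exI conjI) auto
    qed
    show ?thesis
      unfolding C1a_chart_tangent_space[OF c assms(4,1) x]
      by (rule C1a_chart_local_convergence[OF assms(4,5) L assms(1) c hc near charts])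
  qed
  have "C1a_submanifold m \<alpha> S0" using cl0 by (simp add: C1a_class_RLd_def C1a_class_def)
  moreover have "R / 16 > 0" using assms(1) by simp
  ultimately have "C1a_converges m \<alpha> U S0"
    unfolding C1a_converges_def using hc loc by blast
  then show ?thesis using r cl0 unfolding U_def by blast
qed

end
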